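(* Let $\mathbf\Phi=[\mathbf\Phi_1,\dots,\mathbf\Phi_J]$ be the random feature matrix with partition of unity defined in the context, with submatrices $\mathbf B_j$ and $\mathbf D_j$, and assume every $\mathbf B_j$ has at least as many rows as columns. Let $\mathbf B=\operatorname{diag}(\mathbf B_j)_{j=1}^J$, $\mathbf D_o=\operatorname{diag}(\mathbf D_j)_{j\text{ odd}}$ and $\mathbf D_e=\operatorname{diag}(\mathbf D_j)_{j\text{ even}}$ be block diagonal matrices, where $\mathbf D_o$ (resp. $\mathbf D_e$) has $N_o$ (resp. $N_e$) columns. Then for every integer $1\le m\le N_e+N_o$, $$\sigma_m(\mathbf B)\le\sigma_m(\mathbf\Phi)\le\min_{\max(1,m-N_e)\le k\le\min(m,N_o+1)}\sqrt{\sigma_k^2(\mathbf D_o)+\sigma_{m+1-k}^2(\mathbf D_e)},$$ with the convention $\sigma_j(\mathbf D_o)=0$ for $j>N_o$ and $\sigma_j(\mathbf D_e)=0$ for $j>N_e$. In particular, if the numbers $N_j$ of local hidden weights are all equal, then $$\min_j\sigma_{\lceil m/J\rceil}(\mathbf B_j)\le\sigma_m(\mathbf\Phi)\le\sqrt2\,\max_j\sigma_{\lceil m/J\rceil}(\mathbf D_j).$$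
   Context: $\sigma_m(\cdot)$ denotes the $m$-th largest singular value. Let $R>0$, $J\ge2$, $r=R/(J-1)$, $\xi_j=-R+2r(j-1)$ for $1\le j\le J$, and $\phi_j(x)=\phi((x-\xi_j)/r)$ with $$\phi(t)=\mathbf 1_{[-\frac54,-\frac34)}(t)\tfrac{1+\sin(2\pi t)}2+\mathbf 1_{[-\frac34,\frac34)}(t)+\mathbf 1_{[\frac34,\frac54)}(t)\tfrac{1-\sin(2\pi t)}2 .$$ $\phi_j$ and its derivatives are taken to be $0$ outside $(\xi_j-5r/4,\xi_j+5r/4)$. For patch $j$ the local features are $\phi_j(x)\cos(k_{j,q}(x-x_j))$ and $\phi_j(x)\sin(k_{j,q}(x-x_j))$, $1\le q\le N_j$, where the $k_{j,q}$ are real hidden weights and $x_j$ is the center of the interval $(\operatorname{supp}\phi_j)^\circ$ (within $(-R,R)$). Let $Lu=au''+bu'+cu$ on $(-R,R)$ and let $Bu=g_1u'+g_2u$ on $\{\pm R\}$; put $\widetilde L=L$ in $(-R,R)$ and $\widetilde L=\sqrt\gamma B$ at $\pm R$ ($\gamma>0$). Given collocation points $x_1,\dots,x_n\in[-R,R]$ (including $\pm R$), ordered increasingly for the rows, $\mathbf\Phi$ is the matrix whose columns are the values at the collocation points of $\widetilde L$ applied to the local features; $\mathbf\Phi_j$ is the block of columns belonging to patch $j$. Within $\mathbf\Phi_j$, the submatrices $\mathbf A_j,\mathbf B_j,\mathbf C_j$ consist of the rows whose collocation points lie in $(\xi_j-5r/4,\xi_j-3r/4)$, $[\xi_j-3r/4,\xi_j+3r/4]$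 and $(\xi_j+3r/4,\xi_j+5r/4)$ respectively (all other rows of $\mathbf\Phi_j$ are zero). Set $\mathbf D_1=[\mathbf B_1^\top,\mathbf C_1^\top]^\top$, $\mathbf D_j=[\mathbf A_j^\top,\mathbf B_j^\top,\mathbf C_j^\top]^\top$ for $2\le j\le J-1$, and $\mathbf D_J=[\mathbf A_J^\top,\mathbf B_J^\top]^\top$. *)

theory Defs
  imports
    "HOL-Analysis.Analysis"
    "HOL-Computational_Algebra.Polynomial"
    "Jordan_Normal_Form.Char_Poly"
    "Jordan_Normal_Form.DL_Submatrix"
begin

section \<open>Singular values\<close>

text \<open>
  The singular values of a real matrix \<open>A\<close> are the square roots of the eigenvalues of \<open>A\<^sup>T A\<close>,
  repeated according to algebraic multiplicity. For a wide \<open>p \<times> q\<close> matrix (\<open>p < q\<close>) this list has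
  \<open>q - p\<close> additional zeros compared with the convention of having \<open>min p q\<close> singular values; this is
  invisible in \<open>sing_val\<close>, which is \<open>0\<close> beyond the end of the list.
\<close>
definition singular_values :: "real mat \<Rightarrow> real list" where
  "singular_values A =
     rev (sorted_list_of_multiset (image_mset sqrt (proots (char_poly (transpose_mat A * A)))))"

definition sing_val :: "nat \<Rightarrow> real mat \<Rightarrow> real" where
  "sing_val m A =
     (if 1 \<le> m \<and> m \<le> length (singular_values A) then singular_values A ! (m - 1) else 0)"

section \<open>Partition of unity\<close>

definition pou :: "real \<Rightarrow> real" where
  "pou t = indicator {-5/4..<-3/4} t * ((1 + sin (2 * pi * t)) / 2)
         + indicator {-3/4..<3/4} t
         + indicator {3/4..<5/4} t * ((1 - sin (2 * pi * t)) / 2)"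

definition patch_radius :: "real \<Rightarrow> nat \<Rightarrow> real" where
  "patch_radius R J = R / (real J - 1)"

definition patch_node :: "real \<Rightarrow> nat \<Rightarrow> nat \<Rightarrow> real" where
  "patch_node R J j = - R + 2 * patch_radius R J * (real j - 1)"

definition patch_fun :: "real \<Rightarrow> nat \<Rightarrow> nat \<Rightarrow> real \<Rightarrow> real" where
  "patch_fun R J j x = pou ((x - patch_node R J j) / patch_radius R J)"

definition patch_center :: "real \<Rightarrow> nat \<Rightarrow> nat \<Rightarrow> real" where
  "patch_center R J j =
     (let S = interior (closure {x. patch_fun R J j x \<noteq> 0}) \<inter> {-R<..<R}
      in (Inf S + Sup S) / 2)"

section \<open>Local features and the operator applied to them\<close>

definition local_features ::
    "real \<Rightarrow> nat \<Rightarrow> (nat \<Rightarrow> nat) \<Rightarrow> (nat \<Rightarrow> nat \<Rightarrow> real) \<Rightarrow> nat \<Rightarrow> (real \<Rightarrow> real) list" where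
  "local_features R J N k j =
     map (\<lambda>q x. patch_fun R J j x * cos (k j q * (x - patch_center R J j))) [1..<Suc (N j)] @
     map (\<lambda>q x. patch_fun R J j x * sin (k j q * (x - patch_center R J j))) [1..<Suc (N j)]"

text \<open>
  Derivative of a function carried by patch \<open>j\<close>, set to \<open>0\<close> outside the open interval
  \<open>(\<xi>\<^sub>j - 5r/4, \<xi>\<^sub>j + 5r/4)\<close>. The partition function is continuously differentiable, but its second
  derivative jumps at \<open>\<xi>\<^sub>j \<plusminus> 3r/4\<close>. Taking right derivatives assigns a value there which agrees with
  the half-open pieces in the definition of \<open>pou\<close>; wherever the two-sided derivative exists, the
  two coincide.
\<close>
definition patch_deriv :: "real \<Rightarrow> nat \<Rightarrow> nat \<Rightarrow> (real \<Rightarrow> real) \<Rightarrow> real \<Rightarrow> real" where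
  "patch_deriv R J j u x =
     (if x \<in> {patch_node R J j - 5 * patch_radius R J / 4 <..<
             patch_node R J j + 5 * patch_radius R J / 4}
      then vector_derivative u (at_right x) else 0)"

text \<open>
  \<open>L u = a u'' + b u' + c u\<close> in the interior and \<open>\<surd>\<gamma> B u = \<surd>\<gamma> (g\<^sub>1 u' + g\<^sub>2 u)\<close> at \<open>\<plusminus>R\<close>.
  The features are defined on the whole real line and are smooth around \<open>\<plusminus>R\<close>, so the
  derivatives at the end points are the usual ones.
\<close>
definition Ltilde ::
    "real \<Rightarrow> nat \<Rightarrow> (real \<Rightarrow> real) \<Rightarrow> (real \<Rightarrow> real) \<Rightarrow> (real \<Rightarrow> real) \<Rightarrow>
     (real \<Rightarrow> real) \<Rightarrow> (real \<Rightarrow> real) \<Rightarrow> real \<Rightarrow> nat \<Rightarrow> (real \<Rightarrow> real) \<Rightarrow> real \<Rightarrow> real" where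
  "Ltilde R J a b c g1 g2 \<gamma> j u x =
     (if x = - R \<or> x = R
      then sqrt \<gamma> * (g1 x * patch_deriv R J j u x + g2 x * u x)
      else a x * patch_deriv R J j (patch_deriv R J j u) x + b x * patch_deriv R J j u x + c x * u x)"

section \<open>Random feature matrix\<close>

text \<open>The block \<open>\<Phi>\<^sub>j\<close>; it has \<open>2 N\<^sub>j\<close> columns, one per cosine and one per sine feature.\<close>
definition feature_block ::
    "real \<Rightarrow> nat \<Rightarrow> (real \<Rightarrow> real) \<Rightarrow> (real \<Rightarrow> real) \<Rightarrow> (real \<Rightarrow> real) \<Rightarrow>
     (real \<Rightarrow> real) \<Rightarrow> (real \<Rightarrow> real) \<Rightarrow> real \<Rightarrow>
     (nat \<Rightarrow> nat) \<Rightarrow> (nat \<Rightarrow> nat \<Rightarrow> real) \<Rightarrow> real list \<Rightarrow> nat \<Rightarrow> real mat" where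
  "feature_block R J a b c g1 g2 \<gamma> N k xs j =
     (let fs = local_features R J N k j
      in Matrix.mat (length xs) (length fs)
           (\<lambda>(i, l). Ltilde R J a b c g1 g2 \<gamma> j (fs ! l) (xs ! i)))"

text \<open>\<open>[M\<^sub>1, \<dots>, M\<^sub>J]\<close> for matrices with \<open>n\<close> rows\<close>
definition hconcat_mat :: "nat \<Rightarrow> real mat list \<Rightarrow> real mat" where
  "hconcat_mat n Ms = mat_of_cols n (concat (map cols Ms))"

definition rows_in :: "real list \<Rightarrow> real set \<Rightarrow> real mat \<Rightarrow> real mat" where
  "rows_in xs I M = submatrix M {i. i < length xs \<and> xs ! i \<in> I} UNIV"

definition sub_A :: "real \<Rightarrow> nat \<Rightarrow> real list \<Rightarrow> nat \<Rightarrow> real mat \<Rightarrow> real mat" where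
  "sub_A R J xs j = rows_in xs
     {patch_node R J j - 5 * patch_radius R J / 4 <..< patch_node R J j - 3 * patch_radius R J / 4}"

definition sub_B :: "real \<Rightarrow> nat \<Rightarrow> real list \<Rightarrow> nat \<Rightarrow> real mat \<Rightarrow> real mat" where
  "sub_B R J xs j = rows_in xs
     {patch_node R J j - 3 * patch_radius R J / 4 .. patch_node R J j + 3 * patch_radius R J / 4}"

definition sub_C :: "real \<Rightarrow> nat \<Rightarrow> real list \<Rightarrow> nat \<Rightarrow> real mat \<Rightarrow> real mat" where
  "sub_C R J xs j = rows_in xs
     {patch_node R J j + 3 * patch_radius R J / 4 <..< patch_node R J j + 5 * patch_radius R J / 4}"

definition sub_D :: "real \<Rightarrow> nat \<Rightarrow> real list \<Rightarrow> nat \<Rightarrow> real mat \<Rightarrow> real mat" where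
  "sub_D R J xs j M =
     (if j = 1 then sub_B R J xs j M @\<^sub>r sub_C R J xs j M
      else if j = J then sub_A R J xs j M @\<^sub>r sub_B R J xs j M
      else sub_A R J xs j M @\<^sub>r sub_B R J xs j M @\<^sub>r sub_C R J xs j M)"

end

theory Submission
  imports Defs "Jordan_Normal_Form.Schur_Decomposition"
begin

text \<open>
  By the min-max principle, \<open>\<sigma>\<^sub>m(A) \<le> t\<close> holds iff \<open>\<parallel>A x\<parallel> \<le> t \<parallel>x\<parallel>\<close> on the kernel of some matrix with
  fewer than \<open>m\<close> rows. Restricting the rows of \<open>\<Phi>\<close> to those of the \<open>B\<^sub>j\<close>, on which only patch \<open>j\<close> is
  active, gives the block diagonal matrix \<open>B\<close> and hence the lower bound. Patches of equal parity have
  disjoint supports, so the odd (even) columns of \<open>\<Phi>\<close> have the same Gram matrix as \<open>D\<^sub>o\<close> (\<open>D\<^sub>e\<close>);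
  splitting a coefficient vector by parity, intersecting the two kernels and applying the
  Cauchy-Schwarz inequality gives the upper bound. The bounds for the individual blocks follow
  by counting, because the singular values of a block diagonal matrix are those of its blocks.
\<close>

unbundle no vec_syntax

section \<open>Diagonalization of real symmetric matrices\<close>

text \<open>Subspaces never appear as such: each is the kernel of a matrix, and the number of rows
  bounds its codimension. Stacking rows intersects subspaces, a matrix product pulls one back along
  a linear map, and the dimension count behind min-max reduces to the existence of a nonzero kernel
  vector of a wide matrix. The obstacle on the side of \<open>Phi\<close> is that the blocks of
  \<open>B\<close>, \<open>Do\<close> and \<open>De\<close> are cut out and restacked, so their rows
  no longer match those of \<open>Phi\<close>. Singular values depend on the Gram matrix alone, so
  every block may be replaced by columns of full height that vanish off the rows of its patch.
  Labelling columns by pairs (patch, local column) then lets all matrices share one entry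
  function.\<close>

lemma wide_matrix_kernel:
  fixes K :: "'a :: field mat"
  assumes K: "K \<in> carrier_mat r p" and "r < p"
  shows "\<exists>x \<in> carrier_vec p. x \<noteq> 0\<^sub>v p \<and> K *\<^sub>v x = 0\<^sub>v r"
proof -
  \<comment> \<open>\<open>K\<close> is padded with zero rows to a square matrix. Row
    \<open>r\<close> is singled out, although the rows after it are zero too, to match the shape of
    \<open>det_row_0\<close>.\<close>
  define M where "M = mat\<^sub>r p p (\<lambda>i. if i = r then 0\<^sub>v p else if i < r then row K i else 0\<^sub>v p)"
  have M: "M \<in> carrier_mat p p"
    unfolding M_def by simp
  have "det M = 0"
    unfolding M_def using K \<open>r < p\<close> by (intro det_row_0) (auto intro: row_carrier_vec)
  then obtain x where x: "x \<in> carrier_vec p" "x \<noteq> 0\<^sub>v p" "M *\<^sub>v x = 0\<^sub>v p"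
    using det_0_iff_vec_prod_zero_field[OF M] by auto
  have "K *\<^sub>v x = 0\<^sub>v r"
  proof (rule eq_vecI)
    fix i assume "i < dim_vec (0\<^sub>v r :: 'a vec)"
    then have i: "i < r" by simp
    have "(K *\<^sub>v x) $ i = (M *\<^sub>v x) $ i"
      using i \<open>r < p\<close> K unfolding M_def by simp
    then show "(K *\<^sub>v x) $ i = 0\<^sub>v r $ i"
      using i \<open>r < p\<close> x by simp
  qed (use K in auto)
  then show ?thesis using x by auto
qed

text \<open>Supplies the change of basis for deflation: completing \<open>v\<close> to a basis puts
  it first, Gram-Schmidt leaves the first vector alone, and normalization only rescales it. The
  scalar \<open>c\<close> stays anonymous because only the line through \<open>v\<close>
  matters.\<close>

lemma orthonormal_completion:
  fixes v :: "real vec"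
  assumes v: "v \<in> carrier_vec n" "v \<noteq> 0\<^sub>v n"
  shows "\<exists>W \<in> carrier_mat n n. transpose_mat W * W = 1\<^sub>m n \<and> (\<exists>c. col W 0 = c \<cdot>\<^sub>v v)"
proof -
  interpret cof_vec_space n "TYPE(real)" .
  define b where "b = basis_completion v"
  define ws where "ws = gram_schmidt n b"
  from basis_completion[OF v, folded b_def]
  have dist_b: "distinct b" and indep: "\<not> lin_dep (set b)" and b: "set b \<subseteq> carrier_vec n"
    and hdb: "hd b = v" and len_b: "length b = n" by auto
  have n: "n > 0" using v by (cases n) auto
  then obtain vs where bv: "b = v # vs"
    using hdb len_b by (cases b) auto
  from gram_schmidt_result[OF b dist_b indep refl, folded ws_def]
  have ws: "set ws \<subseteq> carrier_vec n" "corthogonal ws" "length ws = n"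
    by (auto simp: len_b)
  have hdws: "hd ws = v"
    using gram_schmidt_hd[OF v(1), of vs, folded bv] unfolding ws_def .
  define W where "W = mat_of_cols n (map (\<lambda>w. (1 / sqrt (w \<bullet> w)) \<cdot>\<^sub>v w) ws)"
  have W: "W \<in> carrier_mat n n"
    using ws unfolding W_def by (metis length_map mat_of_cols_carrier(1))
  have wsc: "ws ! i \<in> carrier_vec n" if "i < n" for i
    using that ws by auto
  have col: "col W i = (1 / sqrt (ws ! i \<bullet> ws ! i)) \<cdot>\<^sub>v (ws ! i)" if "i < n" for i
    using that ws wsc[OF that] unfolding W_def by (subst col_mat_of_cols) auto
  \<comment> \<open>Conjugation is the identity over the reals, so \<open>corthogonal\<close> means
    ordinary orthogonality.\<close>
  have conj: "conjugate w = w" for w :: "real vec"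
    by (rule eq_vecI) auto
  have "transpose_mat W * W = 1\<^sub>m n"
  proof (rule eq_matI)
    fix i j assume ij: "i < dim_row (1\<^sub>m n :: real mat)" "j < dim_col (1\<^sub>m n :: real mat)"
    have orth: "(ws ! i \<bullet> ws ! j = 0) = (i \<noteq> j)"
      using corthogonalD[OF ws(2), of i j] ij ws(3) conj by simp
    have pos: "ws ! i \<bullet> ws ! i \<ge> 0"
      by (auto simp: scalar_prod_def intro: sum_nonneg)
    have "(transpose_mat W * W) $$ (i, j) = col W i \<bullet> col W j"
      using W ij by simp
    also have "\<dots> = (if i = j then 1 else 0)"
      using ij wsc[of i] wsc[of j] orth pos by (auto simp: col)
    finally show "(transpose_mat W * W) $$ (i, j) = 1\<^sub>m n $$ (i, j)"
      using ij by simp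
  qed (use W in auto)
  moreover have "col W 0 = (1 / sqrt (v \<bullet> v)) \<cdot>\<^sub>v v"
    using col[of 0] n hdws ws(3) by (cases ws) auto
  ultimately show ?thesis
    using W by blast
qed

lemma mult_four_block_diag:
  fixes A :: "'a :: comm_ring_1 mat"
  assumes "A \<in> carrier_mat a b" "A' \<in> carrier_mat b c" "D \<in> carrier_mat r s" "D' \<in> carrier_mat s t"
  shows "four_block_mat A (0\<^sub>m a s) (0\<^sub>m r b) D * four_block_mat A' (0\<^sub>m b t) (0\<^sub>m s c) D'
    = four_block_mat (A * A') (0\<^sub>m a t) (0\<^sub>m r c) (D * D')"
  by (subst mult_four_block_mat[of _ a b _ s _ r _ _ c _ t]) (use assms in auto)

text \<open>Spectral theorem by deflation: rotating an eigenvector for \<open>e\<close> into the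
  first coordinate splits off a 1 by 1 block, and the rest has the remaining product as
  characteristic polynomial. The list \<open>es\<close> is prescribed, order included, so that the
  diagonal can later be requested in decreasing order.\<close>

lemma symmetric_mat_diagonalization:
  fixes A :: "real mat"
  assumes "A \<in> carrier_mat n n" and "transpose_mat A = A"
    and "char_poly A = (\<Prod>e\<leftarrow>es. [:- e, 1:])"
  shows "\<exists>P \<in> carrier_mat n n. transpose_mat P * P = 1\<^sub>m n \<and>
    transpose_mat P * A * P = mat_diag n ((!) es)"
  using assms
proof (induction es arbitrary: n A)
  case Nil
  then have "n = 0"
    using degree_monic_char_poly[of A n] by auto
  then show ?case
    using Nil by (intro bexI[of _ "1\<^sub>m n"]) (auto intro!: eq_matI simp: mat_diag_def)
next
  case (Cons e es n A)
  note A = Cons.prems(1) and sym = Cons.prems(2) and cp = Cons.prems(3)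
  have "degree (char_poly A) = Suc (length es)"
    using degree_linear_factors[of uminus "e # es"] unfolding cp by simp
  then obtain k where n: "n = Suc k" and "length es = k"
    using degree_monic_char_poly[OF A] by auto
  have "poly (char_poly A) e = 0"
    unfolding cp by simp
  then obtain v where "eigenvector A v e"
    using eigenvalue_root_char_poly[OF A] unfolding eigenvalue_def by auto
  then have v: "v \<in> carrier_vec n" "v \<noteq> 0\<^sub>v n" "A *\<^sub>v v = e \<cdot>\<^sub>v v"
    using A unfolding eigenvector_def by auto
  obtain W c where W: "W \<in> carrier_mat n n" "transpose_mat W * W = 1\<^sub>m n" "col W 0 = c \<cdot>\<^sub>v v"
    using orthonormal_completion[OF v(1,2)] by blast
  let ?T = transpose_mat
  have WT: "?T W \<in> carrier_mat n n" using W by simp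
  have WWT: "W * ?T W = 1\<^sub>m n"
    using mat_mult_left_right_inverse[OF WT W(1) W(2)] .
  define A' where "A' = ?T W * A * W"
  have A': "A' \<in> carrier_mat n n"
    unfolding A'_def using W A by simp
  have symA': "?T A' = A'"
  proof -
    have "?T A' = ?T W * ?T (?T W * A)"
      unfolding A'_def by (rule transpose_mult) (use W A in auto)
    also have "?T (?T W * A) = A * W"
      by (subst transpose_mult[of _ n n _ n]) (use W A sym in auto)
    finally show ?thesis
      unfolding A'_def using W A by (simp add: assoc_mult_mat[of _ n n _ n _ n])
  qed
  have "similar_mat A' A"
    unfolding similar_mat_def similar_mat_wit_def Let_def
    using W A A' WWT by (intro exI[of _ "?T W"] exI[of _ W]) (auto simp: A'_def)
  then have cp': "char_poly A' = char_poly A"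
    by (rule char_poly_similar)
  have col0: "col A' 0 = e \<cdot>\<^sub>v unit_vec n 0"
  proof -
    have "col A' 0 = ?T W *\<^sub>v (A *\<^sub>v (c \<cdot>\<^sub>v v))"
      using W A v n unfolding A'_def
      by (subst col_mult2[of _ n n _ n]) (auto simp: assoc_mult_mat_vec[of _ n n _ n])
    also have "A *\<^sub>v (c \<cdot>\<^sub>v v) = e \<cdot>\<^sub>v (c \<cdot>\<^sub>v v)"
      using A v by (simp add: mult_mat_vec[of _ n n] smult_smult_assoc mult.commute)
    also have "?T W *\<^sub>v (e \<cdot>\<^sub>v (c \<cdot>\<^sub>v v)) = e \<cdot>\<^sub>v (?T W *\<^sub>v col W 0)"
      using W v WT by (simp add: mult_mat_vec[of _ n n])
    also have "?T W *\<^sub>v col W 0 = col (?T W * W) 0"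
      by (rule col_mult2[symmetric, of _ n n _ n]) (use W n in auto)
    also have "\<dots> = unit_vec n 0"
      using W n by simp
    finally show ?thesis .
  qed
  define A3 where "A3 = mat k k (\<lambda>(i, j). A' $$ (Suc i, Suc j))"
  have A3: "A3 \<in> carrier_mat k k"
    unfolding A3_def by simp
  have c0: "A' $$ (i, 0) = (if i = 0 then e else 0)" if "i < n" for i
    using that arg_cong[OF col0, of "\<lambda>w. w $ i"] A' n by auto
  \<comment> \<open>The first column is known from the eigenvector; symmetry carries its zeros over
    to the first row, which gives the block splitting.\<close>
  have r0: "A' $$ (0, i) = (if i = 0 then e else 0)" if "i < n" for i
    using that c0[OF that] arg_cong[OF symA', of "\<lambda>M. M $$ (i, 0)"] A' n by auto
  have A'_block: "A' = four_block_mat (e \<cdot>\<^sub>m 1\<^sub>m 1) (0\<^sub>m 1 k) (0\<^sub>m k 1) A3"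
    by (rule eq_matI) (use A' n in \<open>auto simp: A3_def c0 r0\<close>)
  have symA3: "?T A3 = A3"
  proof (rule eq_matI)
    fix i j assume "i < dim_row A3" "j < dim_col A3"
    then show "?T A3 $$ (i, j) = A3 $$ (i, j)"
      using arg_cong[OF symA', of "\<lambda>M. M $$ (Suc i, Suc j)"] A' n by (simp add: A3_def)
  qed (simp_all add: A3_def)
  have "char_poly A' = char_poly (e \<cdot>\<^sub>m 1\<^sub>m 1 :: real mat) * char_poly A3"
    unfolding A'_block by (rule char_poly_four_block_zeros_col) (use A3 in auto)
  also have "char_poly (e \<cdot>\<^sub>m 1\<^sub>m 1 :: real mat) = [:- e, 1:]"
    by (simp add: char_poly_defs det_def sign_def)
  finally have "[:- e, 1:] * char_poly A3 = [:- e, 1:] * (\<Prod>e\<leftarrow>es. [:- e, 1:])"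
    unfolding cp' cp by simp
  then have "char_poly A3 = (\<Prod>e\<leftarrow>es. [:- e, 1:])"
    by (metis mult_cancel_left pCons_eq_0_iff zero_neq_one)
  from Cons.IH[OF A3 symA3 this] obtain P where P: "P \<in> carrier_mat k k"
    "?T P * P = 1\<^sub>m k" "?T P * A3 * P = mat_diag k ((!) es)" by blast
  define F where "F = four_block_mat (1\<^sub>m 1) (0\<^sub>m 1 k) (0\<^sub>m k 1) P"
  have F: "F \<in> carrier_mat n n"
    unfolding F_def n using P by (metis four_block_carrier_mat one_carrier_mat plus_1_eq_Suc)
  have FT: "?T F = four_block_mat (1\<^sub>m 1) (0\<^sub>m 1 k) (0\<^sub>m k 1) (?T P)"
    unfolding F_def by (subst transpose_four_block_mat[of _ 1 1 _ k _ k]) (use P in auto)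
  have FTF: "?T F * F = 1\<^sub>m n"
    unfolding FT unfolding F_def
    by (subst mult_four_block_mat[of _ 1 1 _ k _ k _ _ 1 _ k])
       (use P in \<open>auto simp: n\<close>)
  have FAF: "?T F * A' * F = mat_diag n ((!) (e # es))"
  proof -
    have "?T F * A' * F = four_block_mat (e \<cdot>\<^sub>m 1\<^sub>m 1) (0\<^sub>m 1 k) (0\<^sub>m k 1) (?T P * A3 * P)"
      unfolding FT A'_block unfolding F_def
      by (subst mult_four_block_diag[of _ 1 1 _ 1 _ k k _ k], use P A3 in \<open>auto simp del: One_nat_def\<close>)+
    also have "\<dots> = mat_diag n ((!) (e # es))"
      unfolding P(3) by (rule eq_matI) (auto simp: n mat_diag_def nth_Cons')
    finally show ?thesis .
  qed
  have FTc: "?T F \<in> carrier_mat n n" using F by simp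
  define Q where "Q = W * F"
  have Q: "Q \<in> carrier_mat n n" unfolding Q_def using W F by simp
  have QT: "?T Q = ?T F * ?T W"
    unfolding Q_def by (rule transpose_mult) (use W F in auto)
  have "?T Q * Q = ?T F * (?T W * W) * F"
    unfolding QT unfolding Q_def using W(1) F
    by (simp add: assoc_mult_mat[of _ n n _ n _ n])
  then have 1: "?T Q * Q = 1\<^sub>m n"
    using W F FTF by simp
  have "?T Q * A * Q = ?T F * A' * F"
    unfolding QT A'_def unfolding Q_def using W(1) F A
    by (simp add: assoc_mult_mat[of _ n n _ n _ n])
  then show ?case
    using FAF 1 Q by metis
qed

text \<open>The polynomial is factored over the complex numbers, each root is shown to be real, and
  the factorization is pulled back along the injective embedding of real polynomials.\<close>

lemma symmetric_char_poly_splits: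
  fixes A :: "real mat"
  assumes A: "A \<in> carrier_mat n n" and sym: "transpose_mat A = A"
  shows "\<exists>es. char_poly A = (\<Prod>e\<leftarrow>es. [:- e, 1:])"
proof -
  interpret h: map_poly_inj_idom_hom complex_of_real ..
  let ?C = "map_mat complex_of_real A"
  have C: "?C \<in> carrier_mat n n" using A by simp
  obtain as where as: "char_poly ?C = (\<Prod>a\<leftarrow>as. [:- a, 1:])"
    using char_poly_factorized[OF C] by auto
  have real: "a \<in> \<real>" if "a \<in> set as" for a
  proof -
    have "poly (char_poly ?C) a = 0"
      unfolding as poly_prod_list using that by (auto simp: prod_list_zero_iff)
    then obtain v where "eigenvector ?C v a"
      using eigenvalue_root_char_poly[OF C] unfolding eigenvalue_def by auto
    then have v: "v \<in> carrier_vec n" "v \<noteq> 0\<^sub>v n" "?C *\<^sub>v v = a \<cdot>\<^sub>v v"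
      using A unfolding eigenvector_def by auto
    let ?w = "conjugate v"
    have w: "?w \<in> carrier_vec n" using v by simp
    have Cw: "?C *\<^sub>v ?w = cnj a \<cdot>\<^sub>v ?w"
    proof (rule eq_vecI)
      fix i assume "i < dim_vec (cnj a \<cdot>\<^sub>v ?w)"
      then have i: "i < n" using v by simp
      have "(?C *\<^sub>v ?w) $ i = cnj ((?C *\<^sub>v v) $ i)"
        using i A v(1) by (simp add: scalar_prod_def)
      also have "\<dots> = (cnj a \<cdot>\<^sub>v ?w) $ i"
        unfolding v(3) using i v(1) by simp
      finally show "(?C *\<^sub>v ?w) $ i = (cnj a \<cdot>\<^sub>v ?w) $ i" .
    qed (use A v in simp)
    have symC: "transpose_mat ?C = ?C"
      using sym by (metis map_mat_transpose)
    \<comment> \<open>The Hermitian argument in bilinear form: symmetry lets the matrix act on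
      \<open>v\<close> or on its conjugate, which gives \<open>a\<close> and \<open>cnj a\<close>
      times the same nonzero number.\<close>
    have "a * (v \<bullet> ?w) = (?C *\<^sub>v v) \<bullet> ?w"
      unfolding v(3) using v w by simp
    also have "\<dots> = v \<bullet> (?C *\<^sub>v ?w)"
      using transpose_vec_mult_scalar[OF C w v(1)] v w C symC
      by (metis comm_scalar_prod mult_mat_vec_carrier)
    also have "\<dots> = cnj a * (v \<bullet> ?w)"
      unfolding Cw using v w by simp
    finally have "a = cnj a"
      using conjugate_square_eq_0_vec[OF v(1)] v(2) by auto
    then show ?thesis
      by (metis Reals_cnj_iff)
  qed
  then have "map of_real (map Re as) = as"
    by (simp add: map_idI)
  then have "map_poly complex_of_real (char_poly A) = (\<Prod>a\<leftarrow>map of_real (map Re as). [:- a, 1:])"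
    using as of_real_hom.char_poly_hom[OF A] by metis
  also have "\<dots> = (\<Prod>e\<leftarrow>map Re as. map_poly complex_of_real [:- e, 1:])"
    by (simp add: comp_def)
  also have "\<dots> = map_poly complex_of_real (\<Prod>e\<leftarrow>map Re as. [:- e, 1:])"
    by (simp only: h.hom_prod_list list.map_comp comp_def)
  finally show ?thesis
    using h.injectivity by blast
qed

section \<open>Min-max characterization of singular values\<close>

lemma mult_transpose_mat_vec_scalar_prod:
  fixes A :: "'a :: comm_ring_1 mat"
  assumes A: "A \<in> carrier_mat r p" and x: "x \<in> carrier_vec p" and y: "y \<in> carrier_vec p"
  shows "(A *\<^sub>v x) \<bullet> (A *\<^sub>v y) = x \<bullet> (transpose_mat A * A *\<^sub>v y)"
proof -
  have "(A *\<^sub>v x) \<bullet> (A *\<^sub>v y) = (A *\<^sub>v y) \<bullet> (A *\<^sub>v x)"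
    using A x y by (intro comm_scalar_prod[of _ r]) auto
  also have "\<dots> = (transpose_mat A *\<^sub>v (A *\<^sub>v y)) \<bullet> x"
    using A x y by (intro transpose_vec_mult_scalar[symmetric, of _ r p]) auto
  also have "\<dots> = x \<bullet> (transpose_mat A *\<^sub>v (A *\<^sub>v y))"
    using A x y by (intro comm_scalar_prod[of _ p]) auto
  finally show ?thesis
    using A y by (simp add: assoc_mult_mat_vec[of _ p r _ p])
qed

lemma zero_vec_append: "0\<^sub>v (n + m) = 0\<^sub>v n @\<^sub>v 0\<^sub>v m"
  by (rule eq_vecI) auto

text \<open>Intersects two kernels, with the row counts adding up.\<close>

lemma mult_append_rows_eq_0_iff:
  assumes A: "A \<in> carrier_mat r n" and B: "B \<in> carrier_mat s n" and x: "x \<in> carrier_vec n"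
  shows "(A @\<^sub>r B) *\<^sub>v x = 0\<^sub>v (r + s) \<longleftrightarrow> A *\<^sub>v x = 0\<^sub>v r \<and> B *\<^sub>v x = 0\<^sub>v s"
  unfolding mat_mult_append[OF assms] zero_vec_append
  by (rule append_vec_eq[of _ r]) (use A x in auto)

lemma scalar_prod_self_ge_0: "0 \<le> (v :: real vec) \<bullet> v"
  by (auto simp: scalar_prod_def intro: sum_nonneg)

lemma scalar_prod_self_gt_0:
  fixes v :: "real vec"
  assumes "v \<in> carrier_vec n" "v \<noteq> 0\<^sub>v n"
  shows "0 < v \<bullet> v"
proof -
  have "conjugate v = v"
    by (rule eq_vecI) auto
  then show ?thesis
    using conjugate_square_greater_0_vec[OF assms(1)] assms(2) by simp
qed

lemma proots_prod_linear_factors: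
  "proots (\<Prod>e\<leftarrow>es. [:- e, 1:]) = mset (es :: 'a :: idom list)"
proof (induction es)
  case (Cons e es)
  have "(\<Prod>e\<leftarrow>es. [:- e, 1:]) \<noteq> 0"
    by (auto simp: prod_list_zero_iff)
  then have "proots ([:- e, 1:] * (\<Prod>e\<leftarrow>es. [:- e, 1:])) = proots [:- e, 1:] + proots (\<Prod>e\<leftarrow>es. [:- e, 1:])"
    by (intro proots_mult) auto
  then show ?case
    using Cons.IH by (simp del: mult_pCons_left)
qed simp

text \<open>The orthogonal matrix \<open>Q\<close> is the transposed matrix of right singular vectors.\<close>

lemma singular_value_decomposition:
  assumes A: "A \<in> carrier_mat r p"
  shows "length (singular_values A) = p \<and> sorted_wrt (\<ge>) (singular_values A) \<and>
    (\<forall>s \<in> set (singular_values A). 0 \<le> s) \<and>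
    (\<exists>Q \<in> carrier_mat p p. \<forall>x \<in> carrier_vec p. (Q *\<^sub>v x) \<bullet> (Q *\<^sub>v x) = x \<bullet> x \<and>
      (A *\<^sub>v x) \<bullet> (A *\<^sub>v x) = (\<Sum>i<p. (sing_val (Suc i) A)\<^sup>2 * ((Q *\<^sub>v x) $ i)\<^sup>2))"
proof -
  let ?T = transpose_mat
  let ?G = "?T A * A"
  have G: "?G \<in> carrier_mat p p" using A by simp
  have symG: "?T ?G = ?G"
    using A by (subst transpose_mult[of _ p r _ p]) auto
  obtain es0 where es0: "char_poly ?G = (\<Prod>e\<leftarrow>es0. [:- e, 1:])"
    using symmetric_char_poly_splits[OF G symG] by blast
  \<comment> \<open>Decreasing order makes the diagonal agree, position by position, with
    \<open>singular_values\<close>.\<close>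
  define es where "es = rev (sort es0)"
  have mset_es: "mset es = mset es0"
    unfolding es_def by simp
  have es: "char_poly ?G = (\<Prod>e\<leftarrow>es. [:- e, 1:])"
    unfolding es0 by (metis mset_es mset_map prod_mset_prod_list)
  have sorted_es: "sorted_wrt (\<ge>) es"
    unfolding es_def by (simp add: sorted_wrt_rev)
  have len_es: "length es = p"
    using degree_monic_char_poly[OF G] degree_linear_factors[of uminus es] unfolding es by simp
  obtain P where P: "P \<in> carrier_mat p p" "?T P * P = 1\<^sub>m p" "?T P * ?G * P = mat_diag p ((!) es)"
    using symmetric_mat_diagonalization[OF G symG es] by blast
  have PT: "?T P \<in> carrier_mat p p" using P by simp
  have PPT: "P * ?T P = 1\<^sub>m p"
    using mat_mult_left_right_inverse[OF PT P(1) P(2)] .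
  have norm: "(?T P *\<^sub>v x) \<bullet> (?T P *\<^sub>v x) = x \<bullet> x" if x: "x \<in> carrier_vec p" for x
    using mult_transpose_mat_vec_scalar_prod[OF PT x x] PPT x by simp
  have quad: "(A *\<^sub>v x) \<bullet> (A *\<^sub>v x) = (\<Sum>i<p. es ! i * ((?T P *\<^sub>v x) $ i)\<^sup>2)"
    if x: "x \<in> carrier_vec p" for x
  proof -
    define y where "y = ?T P *\<^sub>v x"
    have y: "y \<in> carrier_vec p" unfolding y_def using PT x by simp
    have xy: "x = P *\<^sub>v y"
      unfolding y_def using P PT PPT x by (simp flip: assoc_mult_mat_vec[of _ p p _ p])
    have "(A *\<^sub>v x) \<bullet> (A *\<^sub>v x) = (P *\<^sub>v y) \<bullet> (?G *\<^sub>v (P *\<^sub>v y))"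
      using mult_transpose_mat_vec_scalar_prod[OF A x x] unfolding xy .
    also have "\<dots> = (?G *\<^sub>v (P *\<^sub>v y)) \<bullet> (P *\<^sub>v y)"
      using P y G by (intro comm_scalar_prod[of _ p]) auto
    also have "\<dots> = (?T P *\<^sub>v (?G *\<^sub>v (P *\<^sub>v y))) \<bullet> y"
      using P y G by (intro transpose_vec_mult_scalar[symmetric, of _ p p]) auto
    also have "?T P *\<^sub>v (?G *\<^sub>v (P *\<^sub>v y)) = (?T P * ?G * P) *\<^sub>v y"
      using P(1) PT y G by (simp add: assoc_mult_mat_vec[of _ p p _ p] del: assoc_mult_mat)
    also have "\<dots> \<bullet> y = (\<Sum>i<p. es ! i * (y $ i)\<^sup>2)"
    proof -
      have "(mat_diag p ((!) es) *\<^sub>v y) $ i = es ! i * y $ i" if "i < p" for i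
        using that y
        by (simp add: mat_diag_def scalar_prod_def if_distrib[of "\<lambda>c. c * _"] cong: if_cong)
      then show ?thesis
        unfolding P(3) using y
        by (simp add: scalar_prod_def power2_eq_square lessThan_atLeast0 mult.assoc)
    qed
    finally show ?thesis unfolding y_def .
  qed
  \<comment> \<open>At the \<open>i\<close>-th eigenvector the quadratic form equals the eigenvalue,
    and it is a squared norm.\<close>
  have nonneg: "0 \<le> es ! i" if i: "i < p" for i
  proof -
    define x where "x = P *\<^sub>v unit_vec p i"
    have x: "x \<in> carrier_vec p" unfolding x_def using P by simp
    have y: "?T P *\<^sub>v x = unit_vec p i"
      unfolding x_def using P PT by (simp flip: assoc_mult_mat_vec[of _ p p _ p])
    have "0 \<le> (A *\<^sub>v x) \<bullet> (A *\<^sub>v x)" by (rule scalar_prod_self_ge_0)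
    also have "\<dots> = (\<Sum>j<p. if j = i then es ! j else 0)"
      unfolding quad[OF x] y by (intro sum.cong) (auto simp: unit_vec_def)
    also have "\<dots> = es ! i" using i by simp
    finally show ?thesis .
  qed
  have nonneg_set: "0 \<le> e" if "e \<in> set es" for e
    using that nonneg len_es by (auto simp: in_set_conv_nth)
  have sv: "singular_values A = map sqrt es"
  proof -
    have "singular_values A = rev (sort (map sqrt es))"
      unfolding singular_values_def es proots_prod_linear_factors
      by (simp flip: mset_map add: sorted_list_of_multiset_mset)
    also have "sort (map sqrt es) = rev (map sqrt es)"
    proof (rule properties_for_sort)
      show "sorted (rev (map sqrt es))"
        using sorted_es unfolding sorted_wrt_rev sorted_wrt_map by simp
    qed simp
    finally show ?thesis by simp
  qed
  have sv_nth: "sing_val (Suc i) A = sqrt (es ! i)" if "i < p" for i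
    using that len_es unfolding sing_val_def sv by simp
  have "sorted_wrt (\<ge>) (singular_values A)"
    using sorted_es unfolding sv sorted_wrt_map by simp
  moreover have "(A *\<^sub>v x) \<bullet> (A *\<^sub>v x) = (\<Sum>i<p. (sing_val (Suc i) A)\<^sup>2 * ((?T P *\<^sub>v x) $ i)\<^sup>2)"
    if "x \<in> carrier_vec p" for x
    unfolding quad[OF that] by (intro sum.cong) (auto simp: sv_nth nonneg)
  ultimately show ?thesis
    using PT norm nonneg_set len_es by (auto simp: sv intro!: bexI[of _ "?T P"])
qed

lemma length_singular_values [simp]: "length (singular_values A) = dim_col A"
  using singular_value_decomposition[of A "dim_row A" "dim_col A"] by simp

lemma sorted_singular_values: "sorted_wrt (\<ge>) (singular_values A)"
  using singular_value_decomposition[of A "dim_row A" "dim_col A"] by simp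

lemma sing_val_nonneg: "0 \<le> sing_val m A"
  using singular_value_decomposition[of A "dim_row A" "dim_col A"]
  by (auto simp: sing_val_def)

lemma sing_val_eq_0: "dim_col A < m \<Longrightarrow> sing_val m A = 0"
  by (simp add: sing_val_def)

lemma sing_val_antimono:
  assumes "1 \<le> i" "i \<le> j"
  shows "sing_val j A \<le> sing_val i A"
proof (cases "j \<le> dim_col A \<and> i \<noteq> j")
  case True
  then have "i - 1 < j - 1" "j - 1 < dim_col A"
    using assms by linarith+
  then show ?thesis
    using True assms sorted_wrt_nth_less[OF sorted_singular_values[of A], of "i - 1" "j - 1"]
    by (simp add: sing_val_def)
next
  case False
  then show ?thesis
    using sing_val_nonneg[of i A] sing_val_eq_0[of A j] by force
qed

text \<open>Height and row order of a matrix do not affect its singular values; this allows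
  restacked blocks to be compared with rows of the full matrix.\<close>

lemma sing_val_cong_gram:
  "transpose_mat A * A = transpose_mat B * B \<Longrightarrow> sing_val m A = sing_val m B"
  unfolding sing_val_def singular_values_def by simp

section \<open>The two halves of the min-max principle and their consequences\<close>

lemma sing_val_bound_on_kernel:
  assumes A: "A \<in> carrier_mat r p" and m: "1 \<le> m"
  shows "\<exists>q < m. \<exists>C \<in> carrier_mat q p. \<forall>x \<in> carrier_vec p. C *\<^sub>v x = 0\<^sub>v q \<longrightarrow>
    (A *\<^sub>v x) \<bullet> (A *\<^sub>v x) \<le> (sing_val m A)\<^sup>2 * (x \<bullet> x)"
proof -
  obtain Q where Q: "Q \<in> carrier_mat p p"
    and norm: "\<And>x. x \<in> carrier_vec p \<Longrightarrow> (Q *\<^sub>v x) \<bullet> (Q *\<^sub>v x) = x \<bullet> x"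
    and quad: "\<And>x. x \<in> carrier_vec p \<Longrightarrow>
      (A *\<^sub>v x) \<bullet> (A *\<^sub>v x) = (\<Sum>i<p. (sing_val (Suc i) A)\<^sup>2 * ((Q *\<^sub>v x) $ i)\<^sup>2)"
    using singular_value_decomposition[OF A] by blast
  \<comment> \<open>Orthogonality to the first \<open>m - 1\<close> right singular vectors is
    imposed. \<open>Q\<close> has only \<open>p\<close> rows, hence the minimum; for
    \<open>m > p\<close> the kernel is trivial, in accordance with
    \<open>sing_val m A = 0\<close>.\<close>
  define q where "q = min (m - 1) p"
  define C where "C = mat q p (\<lambda>(i, j). Q $$ (i, j))"
  have bound: "(A *\<^sub>v x) \<bullet> (A *\<^sub>v x) \<le> (sing_val m A)\<^sup>2 * (x \<bullet> x)"
    if x: "x \<in> carrier_vec p" and Cx: "C *\<^sub>v x = 0\<^sub>v q" for x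
  proof -
    have zero: "(Q *\<^sub>v x) $ i = 0" if i: "i < p" "Suc i < m" for i
    proof -
      have "i < q" using i unfolding q_def by simp
      moreover from this have "(Q *\<^sub>v x) $ i = (C *\<^sub>v x) $ i"
        using i Q x unfolding C_def by (simp add: scalar_prod_def)
      ultimately show ?thesis unfolding Cx by simp
    qed
    have "(A *\<^sub>v x) \<bullet> (A *\<^sub>v x) \<le> (\<Sum>i<p. (sing_val m A)\<^sup>2 * ((Q *\<^sub>v x) $ i)\<^sup>2)"
      unfolding quad[OF x]
    proof (rule sum_mono)
      fix i assume "i \<in> {..<p}"
      then show "(sing_val (Suc i) A)\<^sup>2 * ((Q *\<^sub>v x) $ i)\<^sup>2 \<le> (sing_val m A)\<^sup>2 * ((Q *\<^sub>v x) $ i)\<^sup>2"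
        using zero[of i] m sing_val_antimono[of m "Suc i" A] sing_val_nonneg[of "Suc i" A]
        by (cases "Suc i < m") (auto intro!: mult_right_mono power_mono)
    qed
    also have "\<dots> = (sing_val m A)\<^sup>2 * ((Q *\<^sub>v x) \<bullet> (Q *\<^sub>v x))"
      using Q x by (simp add: scalar_prod_def sum_distrib_left power2_eq_square lessThan_atLeast0)
    finally show ?thesis using norm[OF x] by simp
  qed
  show ?thesis
    using bound m by (intro exI[of _ q] conjI bexI[of _ C]) (auto simp: C_def q_def)
qed

text \<open>\<open>C\<close> has fewer than \<open>m\<close> rows, so its kernel meets the span of
  the first \<open>m\<close> right singular vectors, where \<open>A\<close> stretches by at least
  its \<open>m\<close>-th singular value.\<close>

lemma sing_val_le:
  assumes A: "A \<in> carrier_mat r p" and C: "C \<in> carrier_mat q p" and "q < m" and "0 \<le> t"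
    and bound: "\<And>x. x \<in> carrier_vec p \<Longrightarrow> C *\<^sub>v x = 0\<^sub>v q \<Longrightarrow>
      (A *\<^sub>v x) \<bullet> (A *\<^sub>v x) \<le> t\<^sup>2 * (x \<bullet> x)"
  shows "sing_val m A \<le> t"
proof (cases "m \<le> p")
  case False
  then show ?thesis using A \<open>0 \<le> t\<close> by (simp add: sing_val_eq_0)
next
  case True
  obtain Q where Q: "Q \<in> carrier_mat p p"
    and norm: "\<And>x. x \<in> carrier_vec p \<Longrightarrow> (Q *\<^sub>v x) \<bullet> (Q *\<^sub>v x) = x \<bullet> x"
    and quad: "\<And>x. x \<in> carrier_vec p \<Longrightarrow>
      (A *\<^sub>v x) \<bullet> (A *\<^sub>v x) = (\<Sum>i<p. (sing_val (Suc i) A)\<^sup>2 * ((Q *\<^sub>v x) $ i)\<^sup>2)"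
    using singular_value_decomposition[OF A] by blast
  \<comment> \<open>Rows are counted from 0, so the kernel of \<open>E\<close> is the span of the
    first \<open>m\<close> right singular vectors.\<close>
  define E where "E = mat (p - m) p (\<lambda>(i, j). Q $$ (m + i, j))"
  have E: "E \<in> carrier_mat (p - m) p" unfolding E_def by simp
  have CE: "C @\<^sub>r E \<in> carrier_mat (q + (p - m)) p"
    using C E by (rule carrier_append_rows)
  have "q + (p - m) < p"
    using \<open>q < m\<close> True by linarith
  then obtain x where x: "x \<in> carrier_vec p" "x \<noteq> 0\<^sub>v p" and CEx: "(C @\<^sub>r E) *\<^sub>v x = 0\<^sub>v (q + (p - m))"
    using wide_matrix_kernel[OF CE] by blast
  have Cx: "C *\<^sub>v x = 0\<^sub>v q" and Ex: "E *\<^sub>v x = 0\<^sub>v (p - m)"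
    using CEx mult_append_rows_eq_0_iff[OF C E x(1)] by simp_all
  have zero: "(Q *\<^sub>v x) $ i = 0" if i: "m \<le> i" "i < p" for i
  proof -
    have "(Q *\<^sub>v x) $ i = (E *\<^sub>v x) $ (i - m)"
      using i Q x unfolding E_def by (simp add: scalar_prod_def)
    then show ?thesis unfolding Ex using i by simp
  qed
  have "(sing_val m A)\<^sup>2 * (x \<bullet> x) = (sing_val m A)\<^sup>2 * ((Q *\<^sub>v x) \<bullet> (Q *\<^sub>v x))"
    using norm[OF x(1)] by simp
  also have "\<dots> = (\<Sum>i<p. (sing_val m A)\<^sup>2 * ((Q *\<^sub>v x) $ i)\<^sup>2)"
    using Q x by (simp add: scalar_prod_def sum_distrib_left power2_eq_square lessThan_atLeast0)
  also have "\<dots> \<le> (A *\<^sub>v x) \<bullet> (A *\<^sub>v x)"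
    unfolding quad[OF x(1)]
  proof (rule sum_mono)
    fix i assume "i \<in> {..<p}"
    then show "(sing_val m A)\<^sup>2 * ((Q *\<^sub>v x) $ i)\<^sup>2 \<le> (sing_val (Suc i) A)\<^sup>2 * ((Q *\<^sub>v x) $ i)\<^sup>2"
      using zero[of i] sing_val_antimono[of "Suc i" m A] sing_val_nonneg[of m A]
      by (cases "m \<le> i") (auto intro!: mult_right_mono power_mono)
  qed
  also have "\<dots> \<le> t\<^sup>2 * (x \<bullet> x)"
    by (rule bound[OF x(1) Cx])
  finally have "(sing_val m A)\<^sup>2 \<le> t\<^sup>2"
    using scalar_prod_self_gt_0[OF x] by simp
  then show ?thesis
    using \<open>0 \<le> t\<close> by (rule power2_le_imp_le)
qed

lemma sing_val_mono:
  assumes A: "A \<in> carrier_mat r p" and B: "B \<in> carrier_mat s p" and m: "1 \<le> m"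
    and le: "\<And>x. x \<in> carrier_vec p \<Longrightarrow> (B *\<^sub>v x) \<bullet> (B *\<^sub>v x) \<le> (A *\<^sub>v x) \<bullet> (A *\<^sub>v x)"
  shows "sing_val m B \<le> sing_val m A"
proof -
  obtain q C where "q < m" and C: "C \<in> carrier_mat q p"
    and bound: "\<And>x. x \<in> carrier_vec p \<Longrightarrow> C *\<^sub>v x = 0\<^sub>v q \<Longrightarrow>
      (A *\<^sub>v x) \<bullet> (A *\<^sub>v x) \<le> (sing_val m A)\<^sup>2 * (x \<bullet> x)"
    using sing_val_bound_on_kernel[OF A m] by blast
  show ?thesis
    by (rule sing_val_le[OF B C \<open>q < m\<close> sing_val_nonneg]) (use le bound in \<open>blast intro: order_trans\<close>)
qed

lemma scalar_prod_self_add_le: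
  fixes a b :: "real vec"
  assumes a: "a \<in> carrier_vec n" and b: "b \<in> carrier_vec n"
    and au: "a \<bullet> a \<le> \<alpha>\<^sup>2 * u" and bv: "b \<bullet> b \<le> \<beta>\<^sup>2 * v" and "0 \<le> u" "0 \<le> v" "0 \<le> \<alpha>" "0 \<le> \<beta>"
  shows "(a + b) \<bullet> (a + b) \<le> (\<alpha>\<^sup>2 + \<beta>\<^sup>2) * (u + v)"
proof -
  have L2: "sqrt (w \<bullet> w) = L2_set (($) w) {0..<n}" if "w \<in> carrier_vec n" for w
    using that by (simp add: L2_set_def scalar_prod_def power2_eq_square)
  have "sqrt ((a + b) \<bullet> (a + b)) = L2_set (\<lambda>i. a $ i + b $ i) {0..<n}"
    using a b by (subst L2) (auto intro: L2_set_cong)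
  also have "\<dots> \<le> sqrt (a \<bullet> a) + sqrt (b \<bullet> b)"
    unfolding L2[OF a] L2[OF b] by (rule L2_set_triangle_ineq)
  also have "\<dots> \<le> sqrt (\<alpha>\<^sup>2 * u) + sqrt (\<beta>\<^sup>2 * v)"
    using au bv by (intro add_mono real_sqrt_le_mono)
  also have "\<dots> = \<alpha> * sqrt u + \<beta> * sqrt v"
    using assms by (simp add: real_sqrt_mult)
  finally have "(sqrt ((a + b) \<bullet> (a + b)))\<^sup>2 \<le> (\<alpha> * sqrt u + \<beta> * sqrt v)\<^sup>2"
    by (rule power_mono) (simp add: scalar_prod_self_ge_0)
  \<comment> \<open>Cauchy-Schwarz in the plane; the defect is
    \<open>(\<alpha> * sqrt v - \<beta> * sqrt u)\<^sup>2\<close>.\<close>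
  also have "\<dots> \<le> (\<alpha>\<^sup>2 + \<beta>\<^sup>2) * ((sqrt u)\<^sup>2 + (sqrt v)\<^sup>2)"
    using zero_le_power2[of "\<alpha> * sqrt v - \<beta> * sqrt u"]
    by (simp add: power2_eq_square algebra_simps)
  finally show ?thesis
    using assms by (simp add: scalar_prod_self_ge_0)
qed

text \<open>A sharpened form of Weyl's inequality: because the squared norms of the two parts
  \<open>S *\<^sub>v x\<close> and \<open>T *\<^sub>v x\<close> add up to that of \<open>x\<close>,
  the singular values combine as a root of a sum of squares instead of a sum.\<close>

lemma sing_val_split_le:
  assumes M: "M \<in> carrier_mat n p" and A: "A \<in> carrier_mat n p1" and E: "E \<in> carrier_mat n p2"
    and S: "S \<in> carrier_mat p1 p" and T: "T \<in> carrier_mat p2 p"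
    and split: "\<And>x. x \<in> carrier_vec p \<Longrightarrow> M *\<^sub>v x = A *\<^sub>v (S *\<^sub>v x) + E *\<^sub>v (T *\<^sub>v x)"
    and norm: "\<And>x. x \<in> carrier_vec p \<Longrightarrow>
      (S *\<^sub>v x) \<bullet> (S *\<^sub>v x) + (T *\<^sub>v x) \<bullet> (T *\<^sub>v x) = x \<bullet> x"
    and "1 \<le> k" "1 \<le> l" "k + l \<le> m + 1"
  shows "sing_val m M \<le> sqrt ((sing_val k A)\<^sup>2 + (sing_val l E)\<^sup>2)"
proof -
  obtain q1 C1 where "q1 < k" and C1: "C1 \<in> carrier_mat q1 p1"
    and bound1: "\<And>x. x \<in> carrier_vec p1 \<Longrightarrow> C1 *\<^sub>v x = 0\<^sub>v q1 \<Longrightarrow>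
      (A *\<^sub>v x) \<bullet> (A *\<^sub>v x) \<le> (sing_val k A)\<^sup>2 * (x \<bullet> x)"
    using sing_val_bound_on_kernel[OF A \<open>1 \<le> k\<close>] by blast
  obtain q2 C2 where "q2 < l" and C2: "C2 \<in> carrier_mat q2 p2"
    and bound2: "\<And>x. x \<in> carrier_vec p2 \<Longrightarrow> C2 *\<^sub>v x = 0\<^sub>v q2 \<Longrightarrow>
      (E *\<^sub>v x) \<bullet> (E *\<^sub>v x) \<le> (sing_val l E)\<^sup>2 * (x \<bullet> x)"
    using sing_val_bound_on_kernel[OF E \<open>1 \<le> l\<close>] by blast
  have C1S: "C1 * S \<in> carrier_mat q1 p" and C2T: "C2 * T \<in> carrier_mat q2 p"
    using C1 C2 S T by auto
  show ?thesis
  proof (rule sing_val_le[OF M carrier_append_rows[OF C1S C2T]])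
    \<comment> \<open>There are at most \<open>k - 1\<close> and \<open>l - 1\<close> rows, together
      at most \<open>m - 1\<close>.\<close>
    show "q1 + q2 < m" using \<open>q1 < k\<close> \<open>q2 < l\<close> assms by linarith
    fix x assume x: "x \<in> carrier_vec p" and "(C1 * S @\<^sub>r C2 * T) *\<^sub>v x = 0\<^sub>v (q1 + q2)"
    then have "C1 * S *\<^sub>v x = 0\<^sub>v q1" "C2 * T *\<^sub>v x = 0\<^sub>v q2"
      using mult_append_rows_eq_0_iff[OF C1S C2T x] by simp_all
    then have 1: "C1 *\<^sub>v (S *\<^sub>v x) = 0\<^sub>v q1" "C2 *\<^sub>v (T *\<^sub>v x) = 0\<^sub>v q2"
      using x S T C1 C2
      by (simp_all add: assoc_mult_mat_vec[of _ q1 p1 _ p] assoc_mult_mat_vec[of _ q2 p2 _ p])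
    have "(M *\<^sub>v x) \<bullet> (M *\<^sub>v x) \<le> ((sing_val k A)\<^sup>2 + (sing_val l E)\<^sup>2) *
        ((S *\<^sub>v x) \<bullet> (S *\<^sub>v x) + (T *\<^sub>v x) \<bullet> (T *\<^sub>v x))"
      unfolding split[OF x] using x S T A E 1
      by (intro scalar_prod_self_add_le[of _ n] bound1 bound2 scalar_prod_self_ge_0 sing_val_nonneg) auto
    then show "(M *\<^sub>v x) \<bullet> (M *\<^sub>v x) \<le>
        (sqrt ((sing_val k A)\<^sup>2 + (sing_val l E)\<^sup>2))\<^sup>2 * (x \<bullet> x)"
      unfolding norm[OF x] by simp
  qed simp
qed

section \<open>Block diagonal matrices\<close>

text \<open>An upward closed predicate holds on an initial segment of a decreasing list.\<close>

lemma sorted_desc_filter_nth: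
  assumes "sorted_wrt (\<ge>) xs" and "\<And>x y :: 'a :: linorder. P x \<Longrightarrow> x \<le> y \<Longrightarrow> P y" and "i < length xs"
  shows "P (xs ! i) \<longleftrightarrow> i < length (filter P xs)"
  using assms(1,3)
proof (induction xs arbitrary: i)
  case (Cons x xs)
  show ?case
  proof (cases "P x")
    case True
    then show ?thesis using Cons by (cases i) auto
  next
    case False
    then have "\<forall>y \<in> set (x # xs). \<not> P y"
      using Cons.prems(1) assms(2) by auto
    then show ?thesis
      using Cons.prems(2) by (metis filter_False length_0_conv less_nat_zero_code nth_mem)
  qed
qed simp

text \<open>Trades a comparison of the \<open>m\<close>-th singular value with a threshold for a
  count, which is additive over blocks. The condition \<open>\<not> P 0\<close> covers positions
  beyond the list, where \<open>sing_val\<close> is 0.\<close>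

lemma sing_val_filter:
  assumes "\<And>x y. P x \<Longrightarrow> x \<le> y \<Longrightarrow> P y" and "\<not> P 0" and "1 \<le> m"
  shows "P (sing_val m A) \<longleftrightarrow> m \<le> length (filter P (singular_values A))"
proof (cases "m \<le> dim_col A")
  case True
  then have "P (singular_values A ! (m - 1)) \<longleftrightarrow> m - 1 < length (filter P (singular_values A))"
    using \<open>1 \<le> m\<close> assms(1)
    by (intro sorted_desc_filter_nth[OF sorted_singular_values, of P]) (blast, simp)
  moreover have "sing_val m A = singular_values A ! (m - 1)"
    using True \<open>1 \<le> m\<close> by (simp add: sing_val_def)
  moreover have "m - 1 < l \<longleftrightarrow> m \<le> l" for l
    using \<open>1 \<le> m\<close> by linarith
  ultimately show ?thesis
    by simp
next
  case False
  then show ?thesis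
    using \<open>\<not> P 0\<close> length_filter_le[of P "singular_values A"] by (simp add: sing_val_eq_0)
qed

section \<open>Counting the singular values of a block diagonal matrix\<close>

lemma char_poly_four_block_diag:
  fixes A :: "'a :: idom mat"
  assumes A: "A \<in> carrier_mat n n" and D: "D \<in> carrier_mat m m"
  shows "char_poly (four_block_mat A (0\<^sub>m n m) (0\<^sub>m m n) D) = char_poly A * char_poly D"
proof -
  let ?cm = "\<lambda>A :: 'a mat. [:0, 1:] \<cdot>\<^sub>m 1\<^sub>m (dim_row A) + map_mat (\<lambda>a. [:- a:]) A"
  have "?cm (four_block_mat A (0\<^sub>m n m) (0\<^sub>m m n) D)
      = four_block_mat (?cm A) (0\<^sub>m n m) (0\<^sub>m m n) (?cm D)"
    by (rule eq_matI) (use A D in \<open>auto simp: one_poly_def\<close>)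
  then show ?thesis
    using A D unfolding char_poly_defs
    by (simp add: det_four_block_mat_lower_left_zero[of _ n _ m])
qed

lemma gram_diag_block_mat_Cons:
  fixes A :: "'a :: comm_ring_1 mat"
  shows "transpose_mat (diag_block_mat (A # As)) * diag_block_mat (A # As)
    = four_block_mat (transpose_mat A * A) (0\<^sub>m (dim_col A) (dim_col (diag_block_mat As)))
        (0\<^sub>m (dim_col (diag_block_mat As)) (dim_col A))
        (transpose_mat (diag_block_mat As) * diag_block_mat As)"
proof -
  let ?D = "diag_block_mat As" and ?T = transpose_mat
  let ?p = "dim_col A" and ?q = "dim_col ?D"
  have eq: "diag_block_mat (A # As)
      = four_block_mat A (0\<^sub>m (dim_row A) ?q) (0\<^sub>m (dim_row ?D) ?p) ?D"
    by (simp add: Let_def)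
  show ?thesis
    unfolding eq
    by (subst transpose_four_block_mat[of _ "dim_row A" ?p _ ?q _ "dim_row ?D"])
       (auto intro!: mult_four_block_diag)
qed

text \<open>The characteristic polynomial of the Gram matrix is the product over the blocks.
  Equality relies on listing one singular value per column: with \<open>min p q\<close> values for
  each block, a wide block next to a tall one would break the count.\<close>

lemma mset_singular_values_diag_block_mat:
  "mset (singular_values (diag_block_mat As)) = (\<Sum>A\<leftarrow>As. mset (singular_values A))"
proof (induction As)
  case Nil
  then show ?case
    by (simp flip: length_0_conv)
next
  case (Cons A As)
  let ?D = "diag_block_mat As" and ?T = transpose_mat
  have "char_poly (?T (diag_block_mat (A # As)) * diag_block_mat (A # As))
      = char_poly (?T A * A) * char_poly (?T ?D * ?D)"
    unfolding gram_diag_block_mat_Cons by (intro char_poly_four_block_diag) auto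
  moreover have "char_poly (?T M * M) \<noteq> 0" for M :: "real mat"
    using degree_monic_char_poly[of "?T M * M" "dim_col M"] by (metis coeff_0 mult_carrier_mat
        carrier_matI index_transpose_mat(2,3) zero_neq_one)
  ultimately show ?case
    using Cons by (simp add: singular_values_def proots_mult)
qed

lemma length_filter_singular_values_diag_block_mat:
  "length (filter P (singular_values (diag_block_mat As)))
    = (\<Sum>A\<leftarrow>As. length (filter P (singular_values A)))"
proof -
  have "size (filter_mset P (\<Sum>A\<leftarrow>As. mset (singular_values A)))
      = (\<Sum>A\<leftarrow>As. length (filter P (singular_values A)))"
    by (induction As) (simp_all flip: mset_filter)
  then show ?thesis
    unfolding mset_singular_values_diag_block_mat[symmetric] by (simp flip: mset_filter)
qed

text \<open>Each block has at most \<open>s - 1\<close> singular values above \<open>t\<close>, so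
  the whole matrix has fewer than \<open>k\<close> of them.\<close>

lemma sing_val_diag_block_mat_le:
  assumes "1 \<le> s" and "0 \<le> t" and le: "\<And>A. A \<in> set As \<Longrightarrow> sing_val s A \<le> t"
    and "length As * (s - 1) < k"
  shows "sing_val k (diag_block_mat As) \<le> t"
proof -
  \<comment> \<open>The threshold is strict so that 0 fails it even for
    \<open>t = 0\<close>.\<close>
  let ?P = "\<lambda>x. t < x"
  have iff: "?P (sing_val m A) \<longleftrightarrow> m \<le> length (filter ?P (singular_values A))" if "1 \<le> m" for m A
    using that \<open>0 \<le> t\<close> by (intro sing_val_filter) auto
  have "length (filter ?P (singular_values A)) \<le> s - 1" if "A \<in> set As" for A
    using iff[OF \<open>1 \<le> s\<close>, of A] le[OF that] by linarith
  then have "(\<Sum>A\<leftarrow>As. length (filter ?P (singular_values A))) \<le> (\<Sum>A\<leftarrow>As. s - 1)"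
    by (intro sum_list_mono)
  then have "length (filter ?P (singular_values (diag_block_mat As))) < k"
    unfolding length_filter_singular_values_diag_block_mat using assms(4)
    by (simp add: sum_list_triv)
  then show ?thesis
    using iff[of k "diag_block_mat As"] assms(4) by force
qed

lemma sing_val_diag_block_mat_ge:
  assumes "1 \<le> k" and "k \<le> length As * s" and ge: "\<And>A. A \<in> set As \<Longrightarrow> t \<le> sing_val s A"
  shows "t \<le> sing_val k (diag_block_mat As)"
proof (cases "0 < t")
  case False
  then show ?thesis using sing_val_nonneg[of k "diag_block_mat As"] by linarith
next
  case True
  have "1 \<le> s"
    using assms(1,2) by (cases s) auto
  let ?P = "\<lambda>x. t \<le> x"
  have iff: "?P (sing_val m A) \<longleftrightarrow> m \<le> length (filter ?P (singular_values A))" if "1 \<le> m" for m A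
    using that True by (intro sing_val_filter) auto
  have "s \<le> length (filter ?P (singular_values A))" if "A \<in> set As" for A
    using iff[OF \<open>1 \<le> s\<close>, of A] ge[OF that] by blast
  then have "(\<Sum>A\<leftarrow>As. s) \<le> (\<Sum>A\<leftarrow>As. length (filter ?P (singular_values A)))"
    by (intro sum_list_mono)
  then have "k \<le> length (filter ?P (singular_values (diag_block_mat As)))"
    unfolding length_filter_singular_values_diag_block_mat using assms(2)
    by (simp add: sum_list_triv)
  then show ?thesis
    using iff[OF \<open>1 \<le> k\<close>] by blast
qed

text \<open>Labels (block, local column) in the order in which \<open>diag_block_mat\<close> and
  \<open>hconcat_mat\<close> lay out their columns.\<close>

definition block_index :: "(nat \<Rightarrow> nat) \<Rightarrow> nat list \<Rightarrow> (nat \<times> nat) list" where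
  "block_index d js = concat (map (\<lambda>j. map (Pair j) [0..<d j]) js)"

lemma block_index_simps [simp]:
  "block_index d [] = []"
  "block_index d (j # js) = map (Pair j) [0..<d j] @ block_index d js"
  by (simp_all add: block_index_def)

lemma set_block_index: "set (block_index d js) = (SIGMA j:set js. {..<d j})"
  unfolding block_index_def by (auto simp: image_iff)

lemma distinct_block_index: "distinct js \<Longrightarrow> distinct (block_index d js)"
  by (induction js) (auto simp: set_block_index distinct_map inj_on_def)

text \<open>Distinctness matters: equality of block labels decides whether two columns share a
  block, so a repeated label could put nonzero entries outside the diagonal blocks.\<close>

lemma diag_block_mat_map_conv_mat:
  assumes "distinct js" and "\<And>j. j \<in> set js \<Longrightarrow> G j \<in> carrier_mat (d j) (d j)"
  shows "diag_block_mat (map G js) = mat (length (block_index d js)) (length (block_index d js))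
    (\<lambda>(a, b). let (i, k) = block_index d js ! a; (j, l) = block_index d js ! b
      in if i = j then G j $$ (k, l) else 0)"
  using assms
proof (induction js)
  case Nil
  show ?case by (rule eq_matI) auto
next
  case (Cons j js)
  let ?c = "block_index d js" and ?c' = "block_index d (j # js)"
  have G: "G j \<in> carrier_mat (d j) (d j)" using Cons.prems by simp
  have IH: "diag_block_mat (map G js) = mat (length ?c) (length ?c)
    (\<lambda>(a, b). let (i, k) = ?c ! a; (j, l) = ?c ! b in if i = j then G j $$ (k, l) else 0)"
    using Cons by simp
  have nth: "?c' ! a = (if a < d j then (j, a) else ?c ! (a - d j))" for a
    by (simp add: nth_append)
  have notin: "j \<noteq> fst (?c ! a)" if "a < length ?c" for a
    using nth_mem[OF that] Cons.prems(1) by (auto simp: set_block_index)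
  have len: "length ?c' = d j + length ?c"
    by simp
  show ?case
    unfolding list.map diag_block_mat.simps Let_def IH
  proof (rule eq_matI, goal_cases)
    case (1 a b)
    then have "a < d j + length ?c" "b < d j + length ?c"
      unfolding len by auto
    moreover from this have "a - d j < length ?c" if "\<not> a < d j"
      using that by linarith
    moreover from calculation have "b - d j < length ?c" if "\<not> b < d j"
      using that by linarith
    ultimately show ?case
      using G notin[of "a - d j"] notin[of "b - d j"]
      by (auto simp: nth len case_prod_beta simp del: block_index_simps)
  qed (use G in auto)
qed

lemma gram_diag_block_mat:
  fixes As :: "'a :: comm_ring_1 mat list"
  shows "transpose_mat (diag_block_mat As) * diag_block_mat As
    = diag_block_mat (map (\<lambda>A. transpose_mat A * A) As)"
proof (induction As)
  case (Cons A As)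
  have "dim_row (diag_block_mat (map (\<lambda>A. transpose_mat A * A) As)) = dim_col (diag_block_mat As)"
    "dim_col (diag_block_mat (map (\<lambda>A. transpose_mat A * A) As)) = dim_col (diag_block_mat As)"
    unfolding Cons.IH[symmetric] by simp_all
  then show ?case
    unfolding gram_diag_block_mat_Cons Cons.IH by (simp add: Let_def)
qed simp

section \<open>Matrices with columns indexed by a list\<close>

text \<open>Columns are addressed by labels instead of positions, so the full matrix and its odd and
  even parts share one \<open>f\<close> and differ only in the list \<open>cs\<close>.\<close>

definition feature_mat :: "nat \<Rightarrow> (nat \<Rightarrow> 'q \<Rightarrow> 'a) \<Rightarrow> 'q list \<Rightarrow> 'a mat" where
  "feature_mat n f cs = mat n (length cs) (\<lambda>(i, a). f i (cs ! a))"

lemma feature_mat_carrier [simp]: "feature_mat n f cs \<in> carrier_mat n (length cs)"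
  by (simp add: feature_mat_def)

lemma dim_feature_mat [simp]:
  "dim_row (feature_mat n f cs) = n" "dim_col (feature_mat n f cs) = length cs"
  by (simp_all add: feature_mat_def)

lemma feature_mat_cong:
  assumes "\<And>i q. i < n \<Longrightarrow> q \<in> set cs \<Longrightarrow> f i q = g i q"
  shows "feature_mat n f cs = feature_mat n g cs"
  by (rule eq_matI) (simp_all add: feature_mat_def assms)

lemma sum_nth_distinct:
  "distinct cs \<Longrightarrow> (\<Sum>a = 0..<length cs. g (cs ! a)) = (\<Sum>q\<in>set cs. g q)"
  using sum.reindex_bij_betw[OF bij_betw_nth[of cs "{0..<length cs}" "set cs"], of g]
  by (simp add: lessThan_atLeast0)

text \<open>The coefficient of \<open>x\<close> at the label \<open>q\<close>, and 0 for a label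
  that does not occur. The sum avoids a position lookup and has the shape of a row of
  \<open>select_mat\<close> applied to \<open>x\<close>.\<close>

definition coord :: "'q list \<Rightarrow> 'a :: comm_monoid_add vec \<Rightarrow> 'q \<Rightarrow> 'a" where
  "coord cs x q = (\<Sum>b = 0..<length cs. if cs ! b = q then x $ b else 0)"

definition select_mat :: "'q list \<Rightarrow> 'q list \<Rightarrow> 'a :: zero_neq_one mat" where
  "select_mat cs co = mat (length co) (length cs) (\<lambda>(a, b). if co ! a = cs ! b then 1 else 0)"

lemma select_mat_carrier [simp]: "select_mat cs co \<in> carrier_mat (length co) (length cs)"
  by (simp add: select_mat_def)

lemma coord_nth:
  assumes "distinct cs" and "b < length cs"
  shows "coord cs x (cs ! b) = x $ b"
proof -
  have "coord cs x (cs ! b) = (\<Sum>c = 0..<length cs. if c = b then x $ c else 0)"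
    unfolding coord_def using assms by (intro sum.cong) (auto simp: nth_eq_iff_index_eq)
  then show ?thesis using assms by simp
qed

lemma select_mat_mult_index:
  fixes x :: "'a :: semiring_1 vec"
  assumes "x \<in> carrier_vec (length cs)" and "a < length co"
  shows "(select_mat cs co *\<^sub>v x) $ a = coord cs x (co ! a)"
  using assms by (auto simp: select_mat_def coord_def scalar_prod_def intro!: sum.cong)

lemma feature_mat_mult_index:
  fixes x :: "'a :: comm_semiring_1 vec"
  assumes "distinct cs" and "x \<in> carrier_vec (length cs)" and "i < n"
  shows "(feature_mat n f cs *\<^sub>v x) $ i = (\<Sum>q\<in>set cs. f i q * coord cs x q)"
proof -
  have "(feature_mat n f cs *\<^sub>v x) $ i
      = (\<Sum>a = 0..<length cs. f i (cs ! a) * coord cs x (cs ! a))"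
    using assms by (simp add: feature_mat_def scalar_prod_def coord_nth)
  then show ?thesis
    by (simp add: sum_nth_distinct[OF assms(1), of "\<lambda>q. f i q * coord cs x q"])
qed

lemma feature_mat_mult_select_mat_index:
  fixes x :: "'a :: comm_semiring_1 vec"
  assumes "distinct co" and "x \<in> carrier_vec (length cs)" and "i < n"
  shows "(feature_mat n f co *\<^sub>v (select_mat cs co *\<^sub>v x)) $ i = (\<Sum>q\<in>set co. f i q * coord cs x q)"
proof -
  have "(feature_mat n f co *\<^sub>v (select_mat cs co *\<^sub>v x)) $ i
      = (\<Sum>a = 0..<length co. f i (co ! a) * (select_mat cs co *\<^sub>v x) $ a)"
    using assms by (simp add: feature_mat_def scalar_prod_def carrier_matD[OF select_mat_carrier])
  also have "\<dots> = (\<Sum>a = 0..<length co. f i (co ! a) * coord cs x (co ! a))"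
    using assms by (intro sum.cong) (simp_all add: select_mat_mult_index)
  finally show ?thesis
    by (simp add: sum_nth_distinct[OF assms(1), of "\<lambda>q. f i q * coord cs x q"])
qed

lemma scalar_prod_select_mat:
  fixes x :: "'a :: comm_semiring_1 vec"
  assumes "distinct co" and "x \<in> carrier_vec (length cs)"
  shows "(select_mat cs co *\<^sub>v x) \<bullet> (select_mat cs co *\<^sub>v x) = (\<Sum>q\<in>set co. (coord cs x q)\<^sup>2)"
proof -
  have "(select_mat cs co *\<^sub>v x) \<bullet> (select_mat cs co *\<^sub>v x)
      = (\<Sum>a = 0..<length co. (coord cs x (co ! a))\<^sup>2)"
    unfolding scalar_prod_def using assms
    by (intro sum.cong)
      (simp_all add: select_mat_mult_index power2_eq_square carrier_matD[OF select_mat_carrier]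
        del: index_mult_mat_vec)
  then show ?thesis
    by (simp add: sum_nth_distinct[OF assms(1), of "\<lambda>q. (coord cs x q)\<^sup>2"])
qed

lemma scalar_prod_coord:
  fixes x :: "'a :: comm_semiring_1 vec"
  assumes "distinct cs" and "x \<in> carrier_vec (length cs)"
  shows "x \<bullet> x = (\<Sum>q\<in>set cs. (coord cs x q)\<^sup>2)"
proof -
  have "x \<bullet> x = (\<Sum>a = 0..<length cs. (coord cs x (cs ! a))\<^sup>2)"
    unfolding scalar_prod_def using assms by (simp add: coord_nth power2_eq_square)
  then show ?thesis
    by (simp add: sum_nth_distinct[OF assms(1), of "\<lambda>q. (coord cs x q)\<^sup>2"])
qed

text \<open>The selection matrices cut \<open>x\<close> into its coordinates on \<open>co\<close>
  and on \<open>ce\<close>, an orthogonal splitting. Only the sets of labels have to match, so the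
  two families may interleave in \<open>cs\<close>, as odd and even patches do.\<close>

lemma sing_val_feature_mat_split:
  assumes "distinct cs" "distinct co" "distinct ce"
    and un: "set cs = set co \<union> set ce" and disj: "set co \<inter> set ce = {}"
    and "1 \<le> k" "1 \<le> l" "k + l \<le> m + 1"
  shows "sing_val m (feature_mat n f cs)
    \<le> sqrt ((sing_val k (feature_mat n f co))\<^sup>2 + (sing_val l (feature_mat n f ce))\<^sup>2)"
proof (rule sing_val_split_le[OF feature_mat_carrier feature_mat_carrier feature_mat_carrier
      select_mat_carrier[of cs co] select_mat_carrier[of cs ce]])
  fix x :: "real vec"
  assume x: "x \<in> carrier_vec (length cs)"
  show "feature_mat n f cs *\<^sub>v x = feature_mat n f co *\<^sub>v (select_mat cs co *\<^sub>v x)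
      + feature_mat n f ce *\<^sub>v (select_mat cs ce *\<^sub>v x)"
    by (rule eq_vecI)
      (use assms x in \<open>simp_all add: feature_mat_mult_index feature_mat_mult_select_mat_index
        sum.union_disjoint del: index_mult_mat_vec\<close>)
  show "(select_mat cs co *\<^sub>v x) \<bullet> (select_mat cs co *\<^sub>v x)
      + (select_mat cs ce *\<^sub>v x) \<bullet> (select_mat cs ce *\<^sub>v x) = x \<bullet> x"
    using assms x by (simp add: scalar_prod_select_mat scalar_prod_coord sum.union_disjoint)
qed fact+

text \<open>Zeroing a row removes one square from the squared norm of the image.\<close>

lemma sing_val_feature_mat_mono:
  assumes "distinct cs" and "1 \<le> m"
    and rows: "\<And>i. i < n \<Longrightarrow> (\<forall>q\<in>set cs. g i q = f i q) \<or> (\<forall>q\<in>set cs. g i q = 0)"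
  shows "sing_val m (feature_mat n g cs) \<le> sing_val m (feature_mat n f cs)"
proof (rule sing_val_mono[OF feature_mat_carrier feature_mat_carrier \<open>1 \<le> m\<close>])
  fix x :: "real vec"
  assume x: "x \<in> carrier_vec (length cs)"
  have sq: "(feature_mat n h cs *\<^sub>v x) \<bullet> (feature_mat n h cs *\<^sub>v x)
      = (\<Sum>i = 0..<n. (\<Sum>q\<in>set cs. h i q * coord cs x q)\<^sup>2)" for h :: "nat \<Rightarrow> 'a \<Rightarrow> real"
    unfolding scalar_prod_def using assms(1) x
    by (intro sum.cong)
      (simp_all add: feature_mat_mult_index power2_eq_square del: index_mult_mat_vec)
  show "(feature_mat n g cs *\<^sub>v x) \<bullet> (feature_mat n g cs *\<^sub>v x)
      \<le> (feature_mat n f cs *\<^sub>v x) \<bullet> (feature_mat n f cs *\<^sub>v x)"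
    unfolding sq
  proof (rule sum_mono)
    fix i assume "i \<in> {0..<n}"
    then have "(\<forall>q\<in>set cs. g i q = f i q) \<or> (\<forall>q\<in>set cs. g i q = 0)"
      by (intro rows) simp
    then show "(\<Sum>q\<in>set cs. g i q * coord cs x q)\<^sup>2 \<le> (\<Sum>q\<in>set cs. f i q * coord cs x q)\<^sup>2"
      by (elim disjE) simp_all
  qed
qed

text \<open>Columns of full height that vanish off \<open>I j\<close> replace the block
  \<open>X j\<close>; as the sets \<open>I j\<close> are disjoint, columns of different blocks
  remain orthogonal. Only the Gram matrices of the blocks enter, so the way \<open>X j\<close>
  stacks its rows is immaterial.\<close>

lemma sing_val_diag_block_mat_conv_feature_mat:
  assumes "distinct js"
    and X: "\<And>j. j \<in> set js \<Longrightarrow> dim_col (X j) = d j"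
    and gram: "\<And>j k l. j \<in> set js \<Longrightarrow> k < d j \<Longrightarrow> l < d j \<Longrightarrow>
      (transpose_mat (X j) * X j) $$ (k, l) = (\<Sum>i\<in>I j. f i (j, k) * f i (j, l))"
    and I: "\<And>j. j \<in> set js \<Longrightarrow> I j \<subseteq> {0..<n}"
    and disj: "\<And>i j. i \<in> set js \<Longrightarrow> j \<in> set js \<Longrightarrow> i \<noteq> j \<Longrightarrow> I i \<inter> I j = {}"
  shows "sing_val m (diag_block_mat (map X js))
    = sing_val m (feature_mat n (\<lambda>i q. if i \<in> I (fst q) then f i q else 0) (block_index d js))"
proof (rule sing_val_cong_gram)
  let ?c = "block_index d js"
  let ?F = "feature_mat n (\<lambda>i q. if i \<in> I (fst q) then f i q else 0) ?c"
  have "transpose_mat (diag_block_mat (map X js)) * diag_block_mat (map X js)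
      = diag_block_mat (map (\<lambda>j. transpose_mat (X j) * X j) js)"
    unfolding gram_diag_block_mat by (simp add: comp_def)
  also have "\<dots> = mat (length ?c) (length ?c) (\<lambda>(a, b). let (i, k) = ?c ! a; (j, l) = ?c ! b
      in if i = j then (transpose_mat (X j) * X j) $$ (k, l) else 0)"
    using assms(1) X by (intro diag_block_mat_map_conv_mat) auto
  also have "\<dots> = transpose_mat ?F * ?F"
  proof (rule eq_matI, goal_cases)
    case (1 a b)
    then have ab: "a < length ?c" "b < length ?c" by auto
    obtain i k where a: "?c ! a = (i, k)" by fastforce
    obtain j l where b: "?c ! b = (j, l)" by fastforce
    have ik: "i \<in> set js" "k < d i" using nth_mem[OF ab(1)] unfolding a set_block_index by auto
    have jl: "j \<in> set js" "l < d j" using nth_mem[OF ab(2)] unfolding b set_block_index by auto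
    have "(transpose_mat ?F * ?F) $$ (a, b)
        = (\<Sum>x = 0..<n. if x \<in> I i \<inter> I j then f x (i, k) * f x (j, l) else 0)"
      using ab by (auto simp: feature_mat_def scalar_prod_def a b intro!: sum.cong)
    also have "\<dots> = (\<Sum>x\<in>I i \<inter> I j. f x (i, k) * f x (j, l))"
      using I[OF ik(1)] by (subst sum.inter_restrict[symmetric]) (auto intro!: sum.cong)
    also have "\<dots> = (if i = j then (transpose_mat (X j) * X j) $$ (k, l) else 0)"
      using disj[OF ik(1) jl(1)] gram[OF jl(1), of k l] ik jl by auto
    finally show ?case
      using ab by (simp add: a b del: index_mult_mat)
  qed auto
  finally show "transpose_mat (diag_block_mat (map X js)) * diag_block_mat (map X js)
    = transpose_mat ?F * ?F" .
qed

section \<open>The random feature matrix\<close>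

lemma sum_pick:
  assumes "finite K"
  shows "(\<Sum>a = 0..<card K. g (pick K a)) = (\<Sum>i\<in>K. g i)"
proof (rule sum.reindex_bij_betw)
  have inj: "inj_on (pick K) {0..<card K}"
    by (rule inj_onI) (metis atLeastLessThan_iff nat_neq_iff pick_mono order_less_irrefl)
  moreover have "pick K ` {0..<card K} \<subseteq> K"
    by (auto intro: pick_in_set)
  then have "pick K ` {0..<card K} = K"
    using inj \<open>finite K\<close> by (intro card_subset_eq) (auto simp: card_image)
  ultimately show "bij_betw (pick K) {0..<card K} K"
    by (simp add: bij_betw_def)
qed

lemma gram_rows_in:
  assumes M: "M \<in> carrier_mat (length xs) p" and "k < p" "l < p"
  shows "(transpose_mat (rows_in xs S M) * rows_in xs S M) $$ (k, l)
    = (\<Sum>i | i < length xs \<and> xs ! i \<in> S. M $$ (i, k) * M $$ (i, l))"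
proof -
  let ?K = "{i. i < length xs \<and> xs ! i \<in> S}"
  have K: "{i. i < dim_row M \<and> i \<in> ?K} = ?K" and J: "{j. j < dim_col M \<and> j \<in> UNIV} = {..<p}"
    using M by auto
  have dim: "dim_row (rows_in xs S M) = card ?K" "dim_col (rows_in xs S M) = p"
    unfolding rows_in_def dim_submatrix K J by simp_all
  have nth: "rows_in xs S M $$ (a, j) = M $$ (pick ?K a, j)" if "a < card ?K" "j < p" for a j
    unfolding rows_in_def using that
    by (subst submatrix_index) (simp_all only: K J card_lessThan pick_UNIV)
  have "(transpose_mat (rows_in xs S M) * rows_in xs S M) $$ (k, l)
      = (\<Sum>a = 0..<card ?K. M $$ (pick ?K a, k) * M $$ (pick ?K a, l))"
    using assms dim by (simp add: scalar_prod_def nth del: mem_Collect_eq)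
  also have "\<dots> = (\<Sum>i\<in>?K. M $$ (i, k) * M $$ (i, l))"
    by (rule sum_pick) simp
  finally show ?thesis .
qed

lemma dim_col_rows_in [simp]: "dim_col (rows_in xs S M) = dim_col M"
  by (simp add: rows_in_def dim_submatrix)

lemma gram_append_rows:
  assumes A: "A \<in> carrier_mat r p" and B: "B \<in> carrier_mat s p" and "k < p" "l < p"
  shows "(transpose_mat (A @\<^sub>r B) * (A @\<^sub>r B)) $$ (k, l)
    = (transpose_mat A * A) $$ (k, l) + (transpose_mat B * B) $$ (k, l)"
proof -
  have "col (A @\<^sub>r B) j = col A j @\<^sub>v col B j" if "j < p" for j
    using A B that unfolding append_rows_def by (subst col_four_block_mat[of _ r p _ 0 _ s]) auto
  moreover have "dim_col (A @\<^sub>r B) = p"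
    using carrier_append_rows[OF A B] by simp
  ultimately show ?thesis
    using A B \<open>k < p\<close> \<open>l < p\<close>
    by (simp add: scalar_prod_append[of _ r _ s])
qed

lemma hconcat_mat_conv_feature_mat:
  assumes "\<And>j. j \<in> set js \<Longrightarrow> M j \<in> carrier_mat n (d j)"
  shows "hconcat_mat n (map M js) = feature_mat n (\<lambda>i q. M (fst q) $$ (i, snd q)) (block_index d js)"
proof -
  have "concat (map cols (map M js)) = map (\<lambda>q. col (M (fst q)) (snd q)) (block_index d js)"
    using assms
  proof (induction js)
    case (Cons j js)
    have "dim_col (M j) = d j"
      using Cons.prems[of j] by simp
    then show ?case
      using Cons by (simp add: cols_def comp_def)
  qed simp
  then have eq: "hconcat_mat n (map M js)
      = mat_of_cols n (map (\<lambda>q. col (M (fst q)) (snd q)) (block_index d js))"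
    unfolding hconcat_mat_def by simp
  show ?thesis
    unfolding eq
  proof (rule eq_matI, goal_cases)
    case (1 i a)
    then have "i < n" "a < length (block_index d js)" by auto
    moreover from this(2) have "fst (block_index d js ! a) \<in> set js"
      "snd (block_index d js ! a) < d (fst (block_index d js ! a))"
      using nth_mem[of a "block_index d js"] by (auto simp: set_block_index)
    ultimately show ?case
      using assms[of "fst (block_index d js ! a)"]
      by (simp add: mat_of_cols_index feature_mat_def)
  qed auto
qed

section \<open>Supports of the patches and Gram matrices of their blocks\<close>

lemma pou_eq_0:
  assumes "t \<notin> {-5/4<..<5/4}"
  shows "pou t = 0"
proof -
  \<comment> \<open>The left end point belongs to the first half-open piece; the value there is 0
    because the sine equals -1.\<close>
  have "sin (2 * pi * (-5/4)) = - 1"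
  proof -
    have "sin (2 * pi * (-5/4)) = - sin (2 * pi + pi / 2)"
      by (subst sin_minus[symmetric]) (rule arg_cong[of _ _ sin], simp add: algebra_simps)
    also have "sin (2 * pi + pi / 2) = 1"
      by (subst sin_add) simp
    finally show ?thesis .
  qed
  moreover have "t < -5/4 \<or> t = -5/4 \<or> 5/4 \<le> t"
    using assms by auto
  ultimately show ?thesis
    by (auto simp: pou_def indicator_def)
qed

lemma patch_fun_eq_0:
  assumes "0 < patch_radius R J"
    and "x \<notin> {patch_node R J j - 5 * patch_radius R J / 4 <..<
               patch_node R J j + 5 * patch_radius R J / 4}"
  shows "patch_fun R J j x = 0"
proof -
  let ?r = "patch_radius R J" and ?y = "x - patch_node R J j"
  have "?y / ?r \<le> -5/4 \<or> 5/4 \<le> ?y / ?r"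
    using assms(2) unfolding pos_divide_le_eq[OF assms(1)] pos_le_divide_eq[OF assms(1)]
    by (auto simp: not_less)
  then show ?thesis
    unfolding patch_fun_def by (intro pou_eq_0) auto
qed

lemma length_local_features: "length (local_features R J N k j) = N j + N j"
  by (simp add: local_features_def)

lemma local_features_eq_0:
  assumes "u \<in> set (local_features R J N k j)" and "patch_fun R J j x = 0"
  shows "u x = 0"
  using assms by (auto simp: local_features_def)

lemma feature_block_carrier:
  "feature_block R J a b c g1 g2 \<gamma> N k xs j \<in> carrier_mat (length xs) (N j + N j)"
  by (simp add: feature_block_def length_local_features)

text \<open>Locality of the operator: the zeroth order term vanishes with the partition function,
  the derivative terms by the cutoff built into \<open>patch_deriv\<close>. No derivative has to be
  computed.\<close>

lemma feature_block_eq_0: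
  assumes "0 < patch_radius R J" and "i < length xs" and "l < N j + N j"
    and "xs ! i \<notin> {patch_node R J j - 5 * patch_radius R J / 4 <..<
                    patch_node R J j + 5 * patch_radius R J / 4}"
  shows "feature_block R J a b c g1 g2 \<gamma> N k xs j $$ (i, l) = 0"
proof -
  have "(local_features R J N k j ! l) (xs ! i) = 0"
    using assms(3)
    by (intro local_features_eq_0[OF nth_mem patch_fun_eq_0[OF assms(1,4)]])
      (simp add: length_local_features)
  moreover have "patch_deriv R J j u (xs ! i) = 0" for u
    unfolding patch_deriv_def by (rule if_not_P[OF assms(4)])
  ultimately show ?thesis
    using assms(2,3) by (simp add: feature_block_def length_local_features Ltilde_def Let_def)
qed

lemma dim_col_sub_D [simp]: "dim_col (sub_D R J xs j M) = dim_col M"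
  by (simp add: sub_D_def sub_A_def sub_B_def sub_C_def append_rows_def)

lemma dim_col_sub_B [simp]: "dim_col (sub_B R J xs j M) = dim_col M"
  by (simp add: sub_B_def)

text \<open>One formula covers all three cases of \<open>sub_D\<close>: the rows omitted for the
  first and the last patch would belong to collocation points outside
  \<open>{-R..R}\<close>.\<close>

lemma gram_sub_D:
  assumes "R > 0" "J \<ge> 2" and j: "j \<in> {1..J}" and xs: "set xs \<subseteq> {-R..R}"
    and M: "M \<in> carrier_mat (length xs) p" and k: "k < p" and l: "l < p"
  shows "(transpose_mat (sub_D R J xs j M) * sub_D R J xs j M) $$ (k, l)
    = (\<Sum>i | i < length xs \<and> xs ! i \<in> {patch_node R J j - 5 * patch_radius R J / 4 <..<
        patch_node R J j + 5 * patch_radius R J / 4}. M $$ (i, k) * M $$ (i, l))"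
proof -
  let ?r = "patch_radius R J" and ?x = "patch_node R J j"
  have r: "?r > 0" using assms by (simp add: patch_radius_def)
  define SA where "SA = {?x - 5 * ?r / 4 <..< ?x - 3 * ?r / 4}"
  define SB where "SB = {?x - 3 * ?r / 4 .. ?x + 3 * ?r / 4}"
  define SC where "SC = {?x + 3 * ?r / 4 <..< ?x + 5 * ?r / 4}"
  define S where "S = {?x - 5 * ?r / 4 <..< ?x + 5 * ?r / 4}"
  define h where "h T = (\<Sum>i | i < length xs \<and> xs ! i \<in> T. M $$ (i, k) * M $$ (i, l))" for T
  let ?g = "\<lambda>D. (transpose_mat D * D) $$ (k, l)"
  have g: "?g (rows_in xs T M) = h T" for T
    unfolding h_def by (rule gram_rows_in[OF M k l])
  have h_Un: "h (T \<union> U) = h T + h U" if "T \<inter> U = {}" for T U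
  proof -
    have "{i. i < length xs \<and> xs ! i \<in> T \<union> U}
        = {i. i < length xs \<and> xs ! i \<in> T} \<union> {i. i < length xs \<and> xs ! i \<in> U}"
      by auto
    then show ?thesis
      unfolding h_def using that by (auto intro!: sum.union_disjoint)
  qed
  have "S = SA \<union> (SB \<union> SC)"
    unfolding S_def SA_def SB_def SC_def using r by auto
  moreover have "SA \<inter> (SB \<union> SC) = {}" "SB \<inter> SC = {}"
    unfolding SA_def SB_def SC_def using r by auto
  ultimately have hS: "h S = h SA + (h SB + h SC)"
    by (simp add: h_Un)
  have in_xs: "- R \<le> xs ! i" "xs ! i \<le> R" if "i < length xs" for i
    using nth_mem[OF that] xs by auto
  have empty: "h T = 0" if "\<And>i. i < length xs \<Longrightarrow> xs ! i \<notin> T" for T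
    unfolding h_def using that by (intro sum.neutral) blast
  have car: "rows_in xs T M \<in> carrier_mat (dim_row (rows_in xs T M)) p" for T
    using M by auto
  have gg: "?g (rows_in xs T M @\<^sub>r rows_in xs U M) = h T + h U" for T U
    unfolding gram_append_rows[OF car car k l] g ..
  have ggg: "?g (rows_in xs T M @\<^sub>r rows_in xs U M @\<^sub>r rows_in xs V M) = h T + (h U + h V)" for T U V
    unfolding gram_append_rows[OF car carrier_append_rows[OF car car] k l] gg g ..
  have "?g (sub_D R J xs j M) = h S"
  proof -
    consider "j = 1" | "j = J" "j \<noteq> 1" | "j \<noteq> 1" "j \<noteq> J" by blast
    then show ?thesis
    proof cases
      case 1
      then have "?x = - R" by (simp add: patch_node_def)
      \<comment> \<open>The first node is the left end of the domain, so no collocation point lies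
        in the left transition zone.\<close>
      then have "h SA = 0"
        using r in_xs by (intro empty) (force simp: SA_def)
      then show ?thesis
        using 1 gg[of SB SC] hS by (simp add: sub_D_def sub_B_def sub_C_def SB_def SC_def)
    next
      case 2
      then have "?x = R" using assms by (simp add: patch_node_def patch_radius_def)
      then have "h SC = 0"
        using r in_xs by (intro empty) (force simp: SC_def)
      then show ?thesis
        using 2 gg[of SA SB] hS by (simp add: sub_D_def sub_A_def sub_B_def SA_def SB_def)
    next
      case 3
      then show ?thesis
        using ggg[of SA SB SC] hS
        by (simp add: sub_D_def sub_A_def sub_B_def sub_C_def SA_def SB_def SC_def)
    qed
  qed
  then show ?thesis
    unfolding h_def S_def .
qed

lemma patch_node_diff:
  "patch_node R J i - patch_node R J j = 2 * patch_radius R J * (real i - real j)"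
  by (simp add: patch_node_def algebra_simps)

lemma patch_node_gap:
  assumes "0 \<le> patch_radius R J" and "j + g \<le> i"
  shows "patch_node R J j + 2 * patch_radius R J * real g \<le> patch_node R J i"
proof -
  have "2 * patch_radius R J * real g \<le> 2 * patch_radius R J * (real i - real j)"
    using assms by (intro mult_left_mono) auto
  then show ?thesis
    using patch_node_diff[of R J i j] by linarith
qed

text \<open>The last two inequalities pin down the ceiling: \<open>m \<le> J * s\<close> feeds the
  count for the lower bound, \<open>J * (s - 1) < m\<close> the choice of indices for the upper
  bound.\<close>

lemma nat_ceiling_divide_bounds:
  assumes "1 \<le> m" and "1 \<le> (J :: nat)"
  defines "s \<equiv> nat \<lceil>real m / real J\<rceil>"
  shows "1 \<le> s" "m \<le> J * s" "J * (s - 1) < m"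
proof -
  have pos: "0 < real m / real J"
    using assms by simp
  then have s: "real s = of_int \<lceil>real m / real J\<rceil>"
    unfolding s_def by simp
  then show "1 \<le> s"
    using pos by (metis ceiling_divide_upper le_of_int_ceiling less_one not_le of_nat_0 order_less_le_trans)
  have "real m / real J \<le> real s"
    unfolding s by simp
  then have "real m \<le> real (J * s)"
    using assms(2) by (simp add: pos_divide_le_eq mult.commute)
  then show "m \<le> J * s"
    using of_nat_le_iff by blast
  have "real s - 1 < real m / real J"
    unfolding s by linarith
  then have "real (J * (s - 1)) < real m"
    using \<open>1 \<le> s\<close> assms by (simp add: field_simps of_nat_diff)
  then show "J * (s - 1) < m"
    using of_nat_less_iff by blast
qed

theorem theorem3p7:
  fixes R \<gamma> :: real and J :: nat
    and a b c g1 g2 :: "real \<Rightarrow> real"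
    and N :: "nat \<Rightarrow> nat" and k :: "nat \<Rightarrow> nat \<Rightarrow> real"
    and xs :: "real list"
    and Phi_blk B_blk D_blk :: "nat \<Rightarrow> real mat"
    and Phi B Do De :: "real mat"
  defines "Phi_blk \<equiv> feature_block R J a b c g1 g2 \<gamma> N k xs"
    and "B_blk \<equiv> \<lambda>j. sub_B R J xs j (Phi_blk j)"
    and "D_blk \<equiv> \<lambda>j. sub_D R J xs j (Phi_blk j)"
    and "Phi \<equiv> hconcat_mat (length xs) (map Phi_blk [1..<Suc J])"
    and "B \<equiv> diag_block_mat (map B_blk [1..<Suc J])"
    and "Do \<equiv> diag_block_mat (map D_blk (filter odd [1..<Suc J]))"
    and "De \<equiv> diag_block_mat (map D_blk (filter even [1..<Suc J]))"
  assumes "R > 0" and "J \<ge> 2" and "\<gamma> > 0"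
    and "sorted xs" and "set xs \<subseteq> {-R..R}" and "-R \<in> set xs" and "R \<in> set xs"
    and "\<And>j. j \<in> {1..J} \<Longrightarrow> dim_col (B_blk j) \<le> dim_row (B_blk j)"
  shows "(\<forall>m. 1 \<le> m \<and> m \<le> dim_col De + dim_col Do \<longrightarrow>
            sing_val m B \<le> sing_val m Phi \<and>
            sing_val m Phi \<le>
              Min ((\<lambda>i. sqrt ((sing_val i Do)\<^sup>2 + (sing_val (m + 1 - i) De)\<^sup>2)) `
                     {max 1 (m - dim_col De) .. min m (dim_col Do + 1)})) \<and>
         ((\<forall>i\<in>{1..J}. \<forall>j\<in>{1..J}. N i = N j) \<longrightarrow>
          (\<forall>m. 1 \<le> m \<and> m \<le> dim_col De + dim_col Do \<longrightarrow>
            Min ((\<lambda>j. sing_val (nat \<lceil>real m / real J\<rceil>) (B_blk j)) ` {1..J}) \<le> sing_val m Phi \<and>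
            sing_val m Phi \<le>
              sqrt 2 * Max ((\<lambda>j. sing_val (nat \<lceil>real m / real J\<rceil>) (D_blk j)) ` {1..J})))"
proof -
  define n where "n = length xs"
  define d where "d j = N j + N j" for j
  define js where "js = [1..<Suc J]"
  define f where "f i q = Phi_blk (fst q) $$ (i, snd q)" for i and q :: "nat \<times> nat"
  let ?x = "patch_node R J" and ?r = "patch_radius R J"
  define ID where "ID j = {i. i < n \<and> xs ! i \<in> {?x j - 5 * ?r / 4 <..< ?x j + 5 * ?r / 4}}" for j
  define IB where "IB j = {i. i < n \<and> xs ! i \<in> {?x j - 3 * ?r / 4 .. ?x j + 3 * ?r / 4}}" for j
  have r: "0 < ?r"
    using \<open>R > 0\<close> \<open>J \<ge> 2\<close> by (simp add: patch_radius_def)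
  have carrier: "Phi_blk j \<in> carrier_mat n (d j)" for j
    unfolding Phi_blk_def n_def d_def by (rule feature_block_carrier)
  have set_js: "set js = {1..J}" and distinct_js: "distinct js" and length_js: "length js = J"
    unfolding js_def by auto
  have sets: "set (filter P js) = {j \<in> {1..J}. P j}" "distinct (filter P js)" for P
    using set_js distinct_js by auto
  have f_eq_0: "f i q = 0" if "i < n" "i \<notin> ID (fst q)" "snd q < d (fst q)" for i q
    unfolding f_def Phi_blk_def using that r
    by (intro feature_block_eq_0) (simp_all add: ID_def n_def d_def)
  \<comment> \<open>Neighbouring nodes are \<open>2 * ?r\<close> apart, exactly 3/4 plus 5/4 of the
    radius. The two intervals touch, and are disjoint because the plateau is closed and the support
    open.\<close>
  have IB_ID: "IB i \<inter> ID j = {}" if "i \<noteq> j" for i j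
  proof -
    have "i + 1 \<le> j \<or> j + 1 \<le> i" using that by linarith
    then have "?x i + 2 * ?r \<le> ?x j \<or> ?x j + 2 * ?r \<le> ?x i"
      using patch_node_gap[of R J i 1 j] patch_node_gap[of R J j 1 i] r by auto
    then show ?thesis
      using r by (auto simp: IB_def ID_def)
  qed
  \<comment> \<open>Nodes of equal parity are at least \<open>4 * ?r\<close> apart, more than the
    width \<open>5 * ?r / 2\<close> of a support.\<close>
  have ID_ID: "ID i \<inter> ID j = {}" if "i \<noteq> j" "even i = even j" for i j
  proof -
    have "i + 2 \<le> j \<or> j + 2 \<le> i" using that by presburger
    then have "?x i + 4 * ?r \<le> ?x j \<or> ?x j + 4 * ?r \<le> ?x i"
      using patch_node_gap[of R J i 2 j] patch_node_gap[of R J j 2 i] r by auto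
    then show ?thesis
      using r by (auto simp: ID_def)
  qed
  have IB_sub: "IB j \<subseteq> ID j" for j
    using r by (auto simp: IB_def ID_def)
  have Phi: "Phi = feature_mat n f (block_index d js)"
    unfolding Phi_def f_def js_def n_def[symmetric]
    by (rule hconcat_mat_conv_feature_mat) (rule carrier)
  \<comment> \<open>Stated for any predicate that fixes the parity, so that odd and even patches are
    served by one argument.\<close>
  have D: "sing_val m (diag_block_mat (map D_blk (filter P js)))
      = sing_val m (feature_mat n f (block_index d (filter P js)))"
    if P: "\<And>i j. P i \<Longrightarrow> P j \<Longrightarrow> even i = even j" for P m
  proof -
    have "sing_val m (diag_block_mat (map D_blk (filter P js))) = sing_val m (feature_mat n
        (\<lambda>i q. if i \<in> ID (fst q) then f i q else 0) (block_index d (filter P js)))"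
    proof (rule sing_val_diag_block_mat_conv_feature_mat)
      show "distinct (filter P js)" by (rule sets)
      show "dim_col (D_blk j) = d j" for j
        using carrier[of j] by (simp add: D_blk_def)
      show "(transpose_mat (D_blk j) * D_blk j) $$ (k, l) = (\<Sum>i\<in>ID j. f i (j, k) * f i (j, l))"
        if "j \<in> set (filter P js)" "k < d j" "l < d j" for j k l
        using gram_sub_D[OF \<open>R > 0\<close> \<open>J \<ge> 2\<close> _ \<open>set xs \<subseteq> {-R..R}\<close> carrier[unfolded n_def] that(2,3)]
          that(1) unfolding D_blk_def ID_def f_def n_def sets(1) by simp
      show "ID j \<subseteq> {0..<n}" for j
        by (auto simp: ID_def)
      show "ID i \<inter> ID j = {}" if "i \<in> set (filter P js)" "j \<in> set (filter P js)" "i \<noteq> j" for i j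
        using that P by (intro ID_ID) (simp_all add: sets(1))
    qed
    \<comment> \<open>The cutoff to \<open>ID\<close> changes nothing, as a feature column already
      vanishes off the support of its patch.\<close>
    also have "feature_mat n (\<lambda>i q. if i \<in> ID (fst q) then f i q else 0) (block_index d (filter P js))
        = feature_mat n f (block_index d (filter P js))"
      by (rule feature_mat_cong) (auto simp: set_block_index f_eq_0)
    finally show ?thesis .
  qed
  have Do: "sing_val m Do = sing_val m (feature_mat n f (block_index d (filter odd js)))"
    and De: "sing_val m De = sing_val m (feature_mat n f (block_index d (filter even js)))" for m
    unfolding Do_def De_def js_def[symmetric] by (rule D; simp)+
  have B: "sing_val m B = sing_val m
      (feature_mat n (\<lambda>i q. if i \<in> IB (fst q) then f i q else 0) (block_index d js))" for m
    unfolding B_def js_def[symmetric]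
  proof (rule sing_val_diag_block_mat_conv_feature_mat)
    show "dim_col (B_blk j) = d j" for j
      using carrier[of j] by (simp add: B_blk_def)
    show "(transpose_mat (B_blk j) * B_blk j) $$ (k, l) = (\<Sum>i\<in>IB j. f i (j, k) * f i (j, l))"
      if "k < d j" "l < d j" for j k l
      using gram_rows_in[OF carrier[unfolded n_def] that]
      unfolding B_blk_def sub_B_def IB_def f_def n_def by simp
    show "IB j \<subseteq> {0..<n}" for j
      by (auto simp: IB_def)
    show "IB i \<inter> IB j = {}" if "i \<noteq> j" for i j
      using IB_ID[OF that] IB_sub[of j] by blast
  qed (rule distinct_js)
  have lower: "sing_val m B \<le> sing_val m Phi" if "1 \<le> m" for m
    unfolding B Phi
  proof (rule sing_val_feature_mat_mono[OF distinct_block_index[OF distinct_js] that])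
    fix i assume i: "i < n"
    show "(\<forall>q\<in>set (block_index d js). (if i \<in> IB (fst q) then f i q else 0) = f i q) \<or>
      (\<forall>q\<in>set (block_index d js). (if i \<in> IB (fst q) then f i q else 0) = 0)"
    \<comment> \<open>A row in the plateau of patch \<open>j\<close> is zero in all other patches,
      so the cutoff keeps the full row of \<open>Phi\<close>; a row in no plateau is zeroed.\<close>
    proof (cases "\<exists>j. i \<in> IB j")
      case True
      then obtain j where j: "i \<in> IB j" by blast
      have "f i q = 0" if "q \<in> set (block_index d js)" "i \<notin> IB (fst q)" for q
        using that j IB_ID[of j "fst q"] i by (intro f_eq_0) (auto simp: set_block_index)
      then show ?thesis by auto
    qed simp
  qed
  have upper: "sing_val m Phi \<le> sqrt ((sing_val i Do)\<^sup>2 + (sing_val l De)\<^sup>2)"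
    if "1 \<le> i" "1 \<le> l" "i + l \<le> m + 1" for m i l
    unfolding Phi Do De
    by (rule sing_val_feature_mat_split)
      (use that in \<open>auto simp: set_block_index sets distinct_js intro!: distinct_block_index\<close>)
  have bounds: "sing_val m Phi \<le>
      Min ((\<lambda>i. sqrt ((sing_val i Do)\<^sup>2 + (sing_val (m + 1 - i) De)\<^sup>2)) `
        {max 1 (m - dim_col De) .. min m (dim_col Do + 1)})"
    if m: "1 \<le> m" "m \<le> dim_col De + dim_col Do" for m
  proof (rule Min.boundedI)
    \<comment> \<open>The range is nonempty since \<open>m\<close> is at most the number of columns.
      Its bound \<open>i \<le> m\<close> keeps \<open>m + 1 - i\<close> positive, so that
      \<open>upper\<close> applies to each member.\<close>
    have "max 1 (m - dim_col De) \<le> min m (dim_col Do + 1)" using m by auto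
    then show "(\<lambda>i. sqrt ((sing_val i Do)\<^sup>2 + (sing_val (m + 1 - i) De)\<^sup>2)) `
        {max 1 (m - dim_col De) .. min m (dim_col Do + 1)} \<noteq> {}" by simp
  qed (auto intro!: upper)
  have block_bounds:
    "Min ((\<lambda>j. sing_val (nat \<lceil>real m / real J\<rceil>) (B_blk j)) ` {1..J}) \<le> sing_val m Phi \<and>
     sing_val m Phi \<le> sqrt 2 * Max ((\<lambda>j. sing_val (nat \<lceil>real m / real J\<rceil>) (D_blk j)) ` {1..J})"
    if m: "1 \<le> m" for m
  proof -
    define s where "s = nat \<lceil>real m / real J\<rceil>"
    have s: "1 \<le> s" "m \<le> J * s" "J * (s - 1) < m"
      using nat_ceiling_divide_bounds[OF m, of J] \<open>J \<ge> 2\<close> unfolding s_def by auto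
    define u where "u = Min ((\<lambda>j. sing_val s (B_blk j)) ` {1..J})"
    define t where "t = Max ((\<lambda>j. sing_val s (D_blk j)) ` {1..J})"
    have "u \<le> sing_val m B"
      unfolding B_def js_def[symmetric]
      by (rule sing_val_diag_block_mat_ge[OF m, of _ s])
        (use s in \<open>auto simp: u_def length_js set_js intro!: Min_le\<close>)
    then have "u \<le> sing_val m Phi"
      using lower[OF m] by linarith
    moreover have le: "sing_val s (D_blk j) \<le> t" if "j \<in> {1..J}" for j
      unfolding t_def using that by (intro Max_ge) auto
    have "sing_val m Phi \<le> sqrt 2 * t"
    proof -
      have t: "0 \<le> t"
        using le[of 1] sing_val_nonneg[of s "D_blk 1"] \<open>J \<ge> 2\<close> by simp
      \<comment> \<open>The first positions guaranteed to lie past the at most \<open>s - 1\<close>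
        values above \<open>t\<close> in each odd, respectively even, block. They add up to
        \<open>J * (s - 1) + 2\<close>, which is at most \<open>m + 1\<close>; the factor
        \<open>sqrt 2\<close> arises because the same \<open>t\<close> bounds both terms.\<close>
      define i where "i = length (filter odd js) * (s - 1) + 1"
      define l where "l = length (filter even js) * (s - 1) + 1"
      have i: "sing_val i Do \<le> t" and l: "sing_val l De \<le> t"
        unfolding Do_def De_def js_def[symmetric]
        by (rule sing_val_diag_block_mat_le[OF s(1) t]; use le in \<open>force simp: i_def l_def set_js\<close>)+
      have "i + l = (length (filter odd js) + length (filter even js)) * (s - 1) + 2"
        unfolding i_def l_def by (simp add: algebra_simps)
      also have "length (filter odd js) + length (filter even js) = J"
        using sum_length_filter_compl[of odd js] length_js by simp
      finally have "sing_val m Phi \<le> sqrt ((sing_val i Do)\<^sup>2 + (sing_val l De)\<^sup>2)"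
        using s(3) by (intro upper) (simp_all add: i_def l_def)
      also have "\<dots> \<le> sqrt (t\<^sup>2 + t\<^sup>2)"
        using i l by (intro real_sqrt_le_mono add_mono power_mono sing_val_nonneg)
      also have "\<dots> = sqrt 2 * t"
        using t by (simp flip: mult_2 add: real_sqrt_mult)
      finally show ?thesis .
    qed
    ultimately show ?thesis
      unfolding u_def t_def s_def by blast
  qed
  show ?thesis
    using lower bounds block_bounds by blast
qed

end
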